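(* Let $\mathfrak{g}$ be a finite-dimensional simple simply-laced Lie algebra over $\mathbb{C}$ of rank $\ell$ with Cartan matrix $C=(a_{ij})_{i,j=1}^{\ell}$, and define $A(\mathbf{n};q)=A(n_1,\dots,n_\ell;q)\in\mathbb{C}[[q]]$ for $\mathbf{n}=(n_1,\dots,n_\ell)\in\mathbb{Z}^\ell$ by $$\chi_{L(1,0)}(x_1,\dots,x_\ell;q)=\sum_{\mathbf{n}\in\mathbb{Z}^\ell}A(\mathbf{n};q)\,x_1^{n_1}\cdots x_\ell^{n_\ell}.$$ Then for all $\mathbf{n}=(n_1,\dots,n_\ell)\in\mathbb{Z}^\ell$ (regarded as a row vector), $$A(n_1,\dots,n_\ell;q)=A(0,\dots,0;q)\,q^{\frac12\mathbf{n}C\mathbf{n}^{t}}.$$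
   Context: Fix a Cartan subalgebra $\mathfrak{h}$ of $\mathfrak{g}$ and simple roots $\alpha_1,\dots,\alpha_\ell$, and let $\langle\cdot,\cdot\rangle$ be the normalized Killing form, with $\langle\alpha,\alpha\rangle=2$ for all roots $\alpha$ (simply-laced means all roots have the same length, so $C$ is symmetric). $H^{(1)},\dots,H^{(\ell)}\in\mathfrak{h}$ are the fundamental coweights, defined by $\alpha_i(H^{(j)})=\delta_{i,j}$. The untwisted affine Lie algebra is $\hat{\mathfrak{g}}=\mathfrak{g}\otimes\mathbb{C}[t,t^{-1}]\oplus\mathbb{C}c$ with $c$ central and $[a\otimes t^m,b\otimes t^n]=[a,b]\otimes t^{m+n}+m\langle a,b\rangle\delta_{m+n,0}c$. For $a\in\mathfrak{g}$, $n\in\mathbb{Z}$, $a(n)$ denotes the operator by which $a\otimes t^n$ acts on a $\hat{\mathfrak{g}}$-module. $L(1,0)$ is the irreducible highest weight $\hat{\mathfrak{g}}$-module of level $1$ ($c$ acts as $1$) generated by a vector $\mathbf{1}$ annihilated by $\mathfrak{g}\otimes\mathbb{C}[t]$. $L(0)$ is the Virasoro (Sugawara) degree operator on $L(1,0)$: it satisfies $[L(0),a(n)]=-n\,a(n)$ for $a\in\mathfrak{g}$, $n\in\mathbb{Z}$, and $L(0)\mathbf{1}=0$. The multi-parameter character is $$\chi_{L(1,0)}(x_1,\dots,x_\ell;q)=\mathrm{tr}_{L(1,0)}\,x_1^{H^{(1)}(0)}\cdots x_\ell^{H^{(\ell)}(0)}q^{L(0)},$$ i.e. the coefficient of $x_1^{n_1}\cdots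 x_\ell^{n_\ell}q^r$ is the (finite) dimension of the joint eigenspace on which $H^{(j)}(0)$ acts by $n_j$ for all $j$ and $L(0)$ acts by $r$; all these eigenvalues are integers, and those of $L(0)$ are nonnegative. *)

theory Defs
  imports
    Complex_Main
    "HOL-Library.Cardinality"
    "HOL-Library.Poly_Mapping"
    "HOL-Library.Product_Plus"
    "HOL-Computational_Algebra.Formal_Power_Series"
begin

section \<open>Complex Lie algebras\<close>

locale lie_algebra = vector_space scale
  for scale :: "complex \<Rightarrow> 'g::ab_group_add \<Rightarrow> 'g" (infixr \<open>*s\<close> 75) +
  fixes bracket :: "'g \<Rightarrow> 'g \<Rightarrow> 'g" (\<open>\<lbrakk>_, _\<rbrakk>\<close>)
  assumes bracket_add_left: "\<lbrakk>x + y, z\<rbrakk> = \<lbrakk>x, z\<rbrakk> + \<lbrakk>y, z\<rbrakk>"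
    and bracket_add_right: "\<lbrakk>x, y + z\<rbrakk> = \<lbrakk>x, y\<rbrakk> + \<lbrakk>x, z\<rbrakk>"
    and bracket_scale_left: "\<lbrakk>c *s x, y\<rbrakk> = c *s \<lbrakk>x, y\<rbrakk>"
    and bracket_scale_right: "\<lbrakk>x, c *s y\<rbrakk> = c *s \<lbrakk>x, y\<rbrakk>"
    and bracket_self: "\<lbrakk>x, x\<rbrakk> = 0"
    and jacobi: "\<lbrakk>x, \<lbrakk>y, z\<rbrakk>\<rbrakk> + \<lbrakk>y, \<lbrakk>z, x\<rbrakk>\<rbrakk> + \<lbrakk>z, \<lbrakk>x, y\<rbrakk>\<rbrakk> = 0"
begin

definition finite_dim :: bool
  where "finite_dim \<longleftrightarrow> (\<exists>B. finite B \<and> span B = UNIV)"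

definition ideal :: "'g set \<Rightarrow> bool"
  where "ideal I \<longleftrightarrow> subspace I \<and> (\<forall>x. \<forall>y\<in>I. \<lbrakk>x, y\<rbrakk> \<in> I)"

definition simple :: bool
  where "simple \<longleftrightarrow> (\<exists>x y. \<lbrakk>x, y\<rbrakk> \<noteq> 0) \<and> (\<forall>I. ideal I \<longrightarrow> I = {0} \<or> I = UNIV)"

text \<open>The trace is only meaningful when the space is finite-dimensional; \<open>extend_basis {}\<close> is
  an arbitrary basis of it.\<close>

definition linear_trace :: "('g \<Rightarrow> 'g) \<Rightarrow> complex"
  where "linear_trace f =
    (\<Sum>b\<in>extend_basis {}. representation (extend_basis {}) (f b) b)"

definition killing_form :: "'g \<Rightarrow> 'g \<Rightarrow> complex"
  where "killing_form x y = linear_trace (\<lambda>z. \<lbrakk>x, \<lbrakk>y, z\<rbrakk>\<rbrakk>)"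

definition diagonalizable :: "('g \<Rightarrow> 'g) \<Rightarrow> bool"
  where "diagonalizable f \<longleftrightarrow> span {x. \<exists>c. f x = c *s x} = UNIV"

text \<open>For a finite-dimensional semisimple complex Lie algebra, the Cartan subalgebras are the
  self-centralizing abelian subalgebras consisting of ad-diagonalizable elements.\<close>

definition cartan_subalgebra :: "'g set \<Rightarrow> bool"
  where "cartan_subalgebra H \<longleftrightarrow>
    subspace H \<and>
    (\<forall>h\<in>H. \<forall>h'\<in>H. \<lbrakk>h, h'\<rbrakk> = 0) \<and>
    (\<forall>x. (\<forall>h\<in>H. \<lbrakk>h, x\<rbrakk> = 0) \<longrightarrow> x \<in> H) \<and>
    (\<forall>h\<in>H. diagonalizable (\<lambda>x. \<lbrakk>h, x\<rbrakk>))"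

text \<open>A linear functional on the subspace \<open>H\<close> is represented by its extension by \<open>0\<close> to the whole
  type, so that equality of functionals is equality of functions.\<close>

definition dual_space :: "'g set \<Rightarrow> ('g \<Rightarrow> complex) set"
  where "dual_space H =
    {\<alpha>. (\<forall>x\<in>H. \<forall>y\<in>H. \<alpha> (x + y) = \<alpha> x + \<alpha> y) \<and>
        (\<forall>c. \<forall>x\<in>H. \<alpha> (c *s x) = c * \<alpha> x) \<and>
        (\<forall>x. x \<notin> H \<longrightarrow> \<alpha> x = 0)}"

definition root_space :: "'g set \<Rightarrow> ('g \<Rightarrow> complex) \<Rightarrow> 'g set"
  where "root_space H \<alpha> = {x. \<forall>h\<in>H. \<lbrakk>h, x\<rbrakk> = \<alpha> h *s x}"

definition roots :: "'g set \<Rightarrow> ('g \<Rightarrow> complex) set"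
  where "roots H = {\<alpha> \<in> dual_space H. \<alpha> \<noteq> (\<lambda>_. 0) \<and> root_space H \<alpha> \<noteq> {0}}"

definition simple_roots :: "'g set \<Rightarrow> ('l::finite \<Rightarrow> 'g \<Rightarrow> complex) \<Rightarrow> bool"
  where "simple_roots H \<alpha> \<longleftrightarrow>
    (\<forall>i. \<alpha> i \<in> roots H) \<and>
    (\<forall>c :: 'l \<Rightarrow> complex. (\<forall>h\<in>H. (\<Sum>i\<in>UNIV. c i * \<alpha> i h) = 0) \<longrightarrow> (\<forall>i. c i = 0)) \<and>
    (\<forall>\<beta>\<in>roots H. \<exists>k :: 'l \<Rightarrow> int.
        (\<forall>h\<in>H. \<beta> h = (\<Sum>i\<in>UNIV. of_int (k i) * \<alpha> i h)) \<and>
        ((\<forall>i. k i \<ge> 0) \<or> (\<forall>i. k i \<le> 0)))"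

text \<open>A bilinear form \<open>B\<close> on the Lie algebra whose restriction to \<open>H\<close> is nondegenerate induces a
  form on the dual of \<open>H\<close>, by identifying \<open>\<alpha>\<close> with the vector \<open>t\<close> in \<open>H\<close> such that
  \<open>\<alpha> = B t\<close> on \<open>H\<close>.\<close>

definition dual_vector :: "('g \<Rightarrow> 'g \<Rightarrow> complex) \<Rightarrow> 'g set \<Rightarrow> ('g \<Rightarrow> complex) \<Rightarrow> 'g"
  where "dual_vector B H \<alpha> = (THE t. t \<in> H \<and> (\<forall>h\<in>H. B t h = \<alpha> h))"

definition dual_form ::
  "('g \<Rightarrow> 'g \<Rightarrow> complex) \<Rightarrow> 'g set \<Rightarrow> ('g \<Rightarrow> complex) \<Rightarrow> ('g \<Rightarrow> complex) \<Rightarrow> complex"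
  where "dual_form B H \<alpha> \<beta> = B (dual_vector B H \<alpha>) (dual_vector B H \<beta>)"

definition simply_laced :: "'g set \<Rightarrow> bool"
  where "simply_laced H \<longleftrightarrow>
    (\<forall>\<alpha>\<in>roots H. \<forall>\<beta>\<in>roots H. dual_form killing_form H \<alpha> \<alpha> = dual_form killing_form H \<beta> \<beta>)"

definition normalized_killing_form :: "'g set \<Rightarrow> ('g \<Rightarrow> 'g \<Rightarrow> complex) \<Rightarrow> bool"
  where "normalized_killing_form H B \<longleftrightarrow>
    (\<exists>c. \<forall>x y. B x y = c * killing_form x y) \<and>
    (\<forall>\<alpha>\<in>roots H. dual_form B H \<alpha> \<alpha> = 2)"

definition cartan_matrix ::
  "('g \<Rightarrow> 'g \<Rightarrow> complex) \<Rightarrow> 'g set \<Rightarrow> ('l \<Rightarrow> 'g \<Rightarrow> complex) \<Rightarrow> 'l \<Rightarrow> 'l \<Rightarrow> complex"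
  where "cartan_matrix B H \<alpha> i j =
    2 * dual_form B H (\<alpha> i) (\<alpha> j) / dual_form B H (\<alpha> i) (\<alpha> i)"

definition fundamental_coweights :: "'g set \<Rightarrow> ('l \<Rightarrow> 'g \<Rightarrow> complex) \<Rightarrow> ('l \<Rightarrow> 'g) \<Rightarrow> bool"
  where "fundamental_coweights H \<alpha> \<omega> \<longleftrightarrow>
    (\<forall>j. \<omega> j \<in> H) \<and> (\<forall>i j. \<alpha> i (\<omega> j) = (if i = j then 1 else 0))"

end


section \<open>The untwisted affine Lie algebra\<close>

text \<open>The pair \<open>(u, z)\<close> stands for \<open>\<Sum>n. u(n) \<otimes> t^n + z c\<close>.\<close>

type_synonym 'g affine = "(int \<Rightarrow>\<^sub>0 'g) \<times> complex"

definition loop_element :: "'g::ab_group_add \<Rightarrow> int \<Rightarrow> 'g affine"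
  where "loop_element a n = (Poly_Mapping.single n a, 0)"

definition central_element :: "'g::ab_group_add affine"
  where "central_element = (0, 1)"

definition affine_scale ::
  "(complex \<Rightarrow> 'g \<Rightarrow> 'g) \<Rightarrow> complex \<Rightarrow> 'g::ab_group_add affine \<Rightarrow> 'g affine"
  where "affine_scale scale z x = (Poly_Mapping.map (scale z) (fst x), z * snd x)"

definition affine_bracket ::
  "('g \<Rightarrow> 'g \<Rightarrow> 'g) \<Rightarrow> ('g \<Rightarrow> 'g \<Rightarrow> complex) \<Rightarrow> 'g::ab_group_add affine \<Rightarrow> 'g affine \<Rightarrow> 'g affine"
  where "affine_bracket bracket B x y =
    (\<Sum>m\<in>Poly_Mapping.keys (fst x). \<Sum>n\<in>Poly_Mapping.keys (fst y).
      (let a = Poly_Mapping.lookup (fst x) m; b = Poly_Mapping.lookup (fst y) n in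
        (Poly_Mapping.single (m + n) (bracket a b), if m + n = 0 then of_int m * B a b else 0)))"


lemma affine_bracket_superset:
  assumes "finite M" "finite N"
    and "Poly_Mapping.keys (fst x) \<subseteq> M" "Poly_Mapping.keys (fst y) \<subseteq> N"
    and zero: "\<And>a. bracket 0 a = 0" "\<And>a. bracket a 0 = 0" "\<And>a. B 0 a = 0" "\<And>a. B a 0 = 0"
  shows "affine_bracket bracket B x y =
    (\<Sum>m\<in>M. \<Sum>n\<in>N.
      (let a = Poly_Mapping.lookup (fst x) m; b = Poly_Mapping.lookup (fst y) n in
        (Poly_Mapping.single (m + n) (bracket a b), if m + n = 0 then of_int m * B a b else 0)))"
proof -
  have nz: "Poly_Mapping.lookup p m = 0" if "m \<in> T - Poly_Mapping.keys p" for p :: "int \<Rightarrow>\<^sub>0 'a" and m T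
    using that by (simp add: in_keys_iff)
  show ?thesis
    unfolding affine_bracket_def
    by (intro sum.mono_neutral_cong_left assms ballI sum.neutral refl)
      (auto simp: nz zero Let_def zero_prod_def intro!: sum.mono_neutral_left assms sum.neutral)
qed

lemma affine_bracket_loop_element:
  assumes zero: "\<And>a. bracket 0 a = 0" "\<And>a. bracket a 0 = 0" "\<And>a. B 0 a = 0" "\<And>a. B a 0 = 0"
  shows "affine_bracket bracket B (loop_element a m) (loop_element b n) =
    (Poly_Mapping.single (m + n) (bracket a b), if m + n = 0 then of_int m * B a b else 0)"
  by (subst affine_bracket_superset[where M = "{m}" and N = "{n}"])
    (auto simp: zero loop_element_def Let_def)

lemma affine_induct [case_names loop central add]:
  fixes x :: "'g::ab_group_add affine"
  assumes loop: "\<And>a m. P (loop_element a m)" and central: "\<And>z. P (0, z)"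
    and add: "\<And>x y. P x \<Longrightarrow> P y \<Longrightarrow> P (x + y)"
  shows "P x"
proof -
  have "P (u, 0)" for u
  proof (induction u rule: Poly_Mapping.update_induct)
    case const
    show ?case by (rule central)
  next
    case (update f a b)
    have "Poly_Mapping.update a b f = f + Poly_Mapping.single a b"
      using update(1)
      by (intro poly_mapping_eqI) (auto simp: lookup_update lookup_add lookup_single in_keys_iff when_def)
    then show ?case
      using add[OF update(3) loop[of b a]] by (simp add: loop_element_def)
  qed
  from add[OF this[of "fst x"] central[of "snd x"]] show ?thesis by simp
qed

lemma affine_lie_algebra:
  assumes "lie_algebra scale bracket"
    and B_add: "\<And>x y z. B (x + y) z = B x z + B y z"
    and B_scale: "\<And>c x y. B (scale c x) y = c * B x y"
    and B_sym: "\<And>x y. B x y = B y x"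
    and B_invariant: "\<And>x y z. B (bracket x y) z = B x (bracket y z)"
  shows "lie_algebra (affine_scale scale) (affine_bracket bracket B)"
proof -
  interpret lie_algebra scale bracket by fact
  have B_add': "B z (x + y) = B z x + B z y" for x y z
    by (metis B_add B_sym)
  have B_scale': "B x (scale c y) = c * B x y" for c x y
    by (metis B_scale B_sym)
  have zero: "bracket 0 a = 0" "bracket a 0 = 0" "B 0 a = 0" "B a 0 = 0" for a
    using bracket_add_left[of 0 0 a] bracket_add_right[of a 0 0] B_add[of 0 0 a] B_add'[of a 0 0]
    by simp_all
  have anti: "bracket x y = - bracket y x" for x y
    using bracket_self[of "x + y"] unfolding bracket_add_left bracket_add_right
    by (simp add: bracket_self eq_neg_iff_add_eq_0 add.commute)
  let ?b = "affine_bracket bracket B"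
  let ?s = "affine_scale scale"
  note sup = affine_bracket_superset[where bracket = bracket and B = B, OF _ _ _ _ zero]
  note gen = affine_bracket_loop_element[where bracket = bracket and B = B, OF zero]
  have lookup_s: "Poly_Mapping.lookup (fst (?s c x)) m = scale c (Poly_Mapping.lookup (fst x) m)" for c x m
    by (auto simp: affine_scale_def Poly_Mapping.map.rep_eq when_def)
  have snd_s: "snd (?s c x) = c * snd x" for c x
    by (simp add: affine_scale_def)
  have keys_s: "Poly_Mapping.keys (fst (?s c x)) \<subseteq> Poly_Mapping.keys (fst x)" for c x
    by (auto simp: in_keys_iff lookup_s)
  have s_eqI: "x = y" if "\<And>m. Poly_Mapping.lookup (fst x) m = Poly_Mapping.lookup (fst y) m" "snd x = snd y"
    for x y :: "'a affine"
    using that by (metis poly_mapping_eqI prod_eqI)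
  interpret A: vector_space ?s
    by unfold_locales
      (rule s_eqI; simp add: lookup_s snd_s lookup_add scale_right_distrib scale_left_distrib algebra_simps)+
  have add_left: "?b (x + y) z = ?b x z + ?b y z" for x y z
  proof -
    let ?M = "Poly_Mapping.keys (fst x) \<union> Poly_Mapping.keys (fst y)"
    have "Poly_Mapping.keys (fst (x + y)) \<subseteq> ?M"
      by (simp add: Poly_Mapping.keys_add)
    then show ?thesis
      by (simp add: sup[where M = ?M and N = "Poly_Mapping.keys (fst z)" and x = x and y = z] sup[where M = ?M and N = "Poly_Mapping.keys (fst z)" and x = y and y = z]
          sup[where M = ?M and N = "Poly_Mapping.keys (fst z)" and x = "x + y" and y = z] Let_def lookup_add bracket_add_left B_add
          single_add algebra_simps flip: sum.distrib) (auto intro!: sum.cong simp: B_add B_add' algebra_simps)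
  qed
  have add_right: "?b z (x + y) = ?b z x + ?b z y" for x y z
  proof -
    let ?M = "Poly_Mapping.keys (fst x) \<union> Poly_Mapping.keys (fst y)"
    have "Poly_Mapping.keys (fst (x + y)) \<subseteq> ?M"
      by (simp add: Poly_Mapping.keys_add)
    then show ?thesis
      by (simp add: sup[where M = "Poly_Mapping.keys (fst z)" and N = ?M and x = z and y = x] sup[where M = "Poly_Mapping.keys (fst z)" and N = ?M and x = z and y = y]
          sup[where M = "Poly_Mapping.keys (fst z)" and N = ?M and x = z and y = "x + y"] Let_def lookup_add bracket_add_right B_add'
          single_add algebra_simps flip: sum.distrib) (auto intro!: sum.cong simp: B_add B_add' algebra_simps)
  qed
  have s_pair: "?s c (Poly_Mapping.single k a, z) = (Poly_Mapping.single k (scale c a), c * z)" for c k a z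
    by (simp add: affine_scale_def)
  have scale_left: "?b (?s c x) y = ?s c (?b x y)" for c x y
    unfolding sup[OF finite_keys finite_keys keys_s order_refl]
    by (subst sup[OF finite_keys finite_keys order_refl order_refl])
      (auto simp: A.scale_sum_right Let_def lookup_s bracket_scale_left B_scale s_pair intro!: sum.cong)
  have scale_right: "?b x (?s c y) = ?s c (?b x y)" for c x y
    unfolding sup[OF finite_keys finite_keys order_refl keys_s]
    by (subst sup[OF finite_keys finite_keys order_refl order_refl])
      (auto simp: A.scale_sum_right Let_def lookup_s bracket_scale_right B_scale' s_pair intro!: sum.cong)
  have central: "?b (0, z) x = 0" "?b x (0, z) = 0" for x z
    by (simp_all add: affine_bracket_def)
  have b_zero: "?b 0 x = 0" "?b x 0 = 0" for x
    by (simp_all add: affine_bracket_def)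
  have pair: "(Poly_Mapping.single k a, z) = loop_element a k + (0, z)" for k a z
    by (simp add: loop_element_def)
  have anti': "?b x y = - ?b y x" for x y
  proof (induction x rule: affine_induct)
    case (loop a m)
    show ?case
    proof (induction y rule: affine_induct)
      case (loop b n)
      have eq: "bracket a b = - bracket b a" by (rule anti)
      have "m + n = 0 \<longleftrightarrow> n + m = 0" "m + n = 0 \<Longrightarrow> (of_int m :: complex) = - of_int n"
        by (auto simp: eq_neg_iff_add_eq_0 simp flip: of_int_add)
      then show ?case
        unfolding gen by (auto simp: eq B_sym[of a b] add.commute single_uminus)
    qed (auto simp: central add_left add_right)
  qed (auto simp: central add_left add_right)
  have self: "?b x x = 0" for x
  proof (induction x rule: affine_induct)
    case (loop a m)
    show ?case unfolding gen by (simp add: bracket_self zero_prod_def)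
  next
    case (add x y)
    then show ?case using anti'[of x y] by (simp add: add_left add_right)
  qed (simp add: central)
  have gen2: "?b (loop_element a k) (?b (loop_element b m) (loop_element c n)) =
      (Poly_Mapping.single (k + m + n) (bracket a (bracket b c)),
       if k + m + n = 0 then of_int k * B a (bracket b c) else 0)" for a b c k m n
    unfolding gen[of b m] pair[of "m + n"] add_right central add_0_right gen by (simp add: add.assoc)
  have sum3: "(p + p') + (q + q') + (r + r') = 0" if "p + q + r = 0" "p' + q' + r' = 0"
    for p q r p' q' r' :: "'a affine"
  proof -
    have "(p + p') + (q + q') + (r + r') = (p + q + r) + (p' + q' + r')"
      by (simp only: ac_simps)
    then show ?thesis using that by simp
  qed
  have jac: "?b x (?b y z) + ?b y (?b z x) + ?b z (?b x y) = 0" for x y z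
  proof (induction x rule: affine_induct)
    case (loop a k)
    show ?case
    proof (induction y rule: affine_induct)
      case (loop b m)
      show ?case
      proof (induction z rule: affine_induct)
        case (loop c n)
        have 1: "B b (bracket c a) = B a (bracket b c)"
          by (metis B_invariant B_sym)
        have 2: "B c (bracket a b) = B a (bracket b c)"
          by (metis B_invariant B_sym)
        have 3: "m + n + k = k + m + n" "n + k + m = k + m + n"
          by simp_all
        have 4: "of_int k * z + of_int m * z + of_int n * z = 0" if "k + m + n = 0" for z :: complex
          using that by (metis distrib_right mult_zero_left of_int_0 of_int_add)
        show ?case
          unfolding gen2 3 1 2
          using 4 by (simp add: zero_prod_def jacobi flip: single_add)
      next
        case (add x y)
        show ?case unfolding add_left add_right by (rule sum3[OF add])
      qed (simp add: central b_zero)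
    next
      case (add x y)
      show ?case unfolding add_left add_right by (rule sum3[OF add])
    qed (simp add: central b_zero)
  next
    case (add x y)
    show ?case unfolding add_left add_right by (rule sum3[OF add])
  qed (simp add: central b_zero)
  show ?thesis
    by unfold_locales (fact add_left add_right scale_left scale_right self jac)+
qed


section \<open>Modules\<close>

locale lie_module =
  lie_algebra scale bracket + V: vector_space vscale
  for scale :: "complex \<Rightarrow> 'g::ab_group_add \<Rightarrow> 'g"
    and bracket :: "'g \<Rightarrow> 'g \<Rightarrow> 'g"
    and vscale :: "complex \<Rightarrow> 'v::ab_group_add \<Rightarrow> 'v" +
  fixes act :: "'g \<Rightarrow> 'v \<Rightarrow> 'v"
  assumes act_add_left: "act (x + y) v = act x v + act y v"
    and act_scale_left: "act (scale c x) v = vscale c (act x v)"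
    and act_add_right: "act x (v + w) = act x v + act x w"
    and act_scale_right: "act x (vscale c v) = vscale c (act x v)"
    and act_bracket: "act (bracket x y) v = act x (act y v) - act y (act x v)"
begin

definition submodule :: "'v set \<Rightarrow> bool"
  where "submodule U \<longleftrightarrow> V.subspace U \<and> (\<forall>x. \<forall>u\<in>U. act x u \<in> U)"

definition irreducible :: bool
  where "irreducible \<longleftrightarrow> (\<exists>v::'v. v \<noteq> 0) \<and> (\<forall>U. submodule U \<longrightarrow> U = {0} \<or> U = UNIV)"

definition generates :: "'v \<Rightarrow> bool"
  where "generates v \<longleftrightarrow> (\<forall>U. submodule U \<and> v \<in> U \<longrightarrow> U = UNIV)"

end

text \<open>The module \<open>L(1,0)\<close>, which these properties determine up to isomorphism.\<close>

locale basic_module =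
  lie_module "affine_scale scale" "affine_bracket bracket B" vscale act
  for scale :: "complex \<Rightarrow> 'g::ab_group_add \<Rightarrow> 'g"
    and bracket :: "'g \<Rightarrow> 'g \<Rightarrow> 'g"
    and B :: "'g \<Rightarrow> 'g \<Rightarrow> complex"
    and vscale :: "complex \<Rightarrow> 'v::ab_group_add \<Rightarrow> 'v"
    and act :: "'g affine \<Rightarrow> 'v \<Rightarrow> 'v" +
  fixes vac :: 'v
  assumes irreducible: "irreducible"
    and level_one: "act central_element v = v"
    and vac_generates: "generates vac"
    and vac_annihilated: "n \<ge> 0 \<Longrightarrow> act (loop_element a n) vac = 0"
begin

text \<open>The operator \<open>L(0)\<close>, determined by these properties (\<open>degree_operator_unique\<close> below).\<close>

definition degree_operator :: "('v \<Rightarrow> 'v) \<Rightarrow> bool"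
  where "degree_operator D \<longleftrightarrow>
    Vector_Spaces.linear vscale vscale D \<and>
    (\<forall>a n v. D (act (loop_element a n) v) - act (loop_element a n) (D v) =
      vscale (- of_int n) (act (loop_element a n) v)) \<and>
    D vac = 0"

lemma degree_operator_unique:
  assumes "degree_operator D" "degree_operator D'"
  shows "D = D'"
proof -
  interpret D: Vector_Spaces.linear vscale vscale D
    using assms(1) by (simp add: degree_operator_def)
  interpret D': Vector_Spaces.linear vscale vscale D'
    using assms(2) by (simp add: degree_operator_def)
  define U where "U = {v. D v = D' v}"
  have comm: "E (act (loop_element a n) v) =
      act (loop_element a n) (E v) + vscale (- of_int n) (act (loop_element a n) v)"
    if "degree_operator E" for E a n v
    using that unfolding degree_operator_def by (metis diff_add_cancel add.commute)
  have "V.subspace U"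
    by (rule V.subspaceI) (simp_all add: U_def D.zero D'.zero D.add D'.add D.scale D'.scale)
  moreover have "act x v \<in> U" if "v \<in> U" for x v
  proof (induction x rule: affine_induct)
    case (loop a m)
    show ?case using that by (simp add: U_def comm[OF assms(1)] comm[OF assms(2)])
  next
    case (central z)
    have "(0, z) = affine_scale scale z central_element"
      by (simp add: affine_scale_def central_element_def Poly_Mapping.map_eq_zero_iff)
    then have "act (0, z) v = vscale z v"
      by (simp only: act_scale_left level_one)
    then show ?case using that by (simp add: U_def D.scale D'.scale)
  next
    case (add x y)
    then show ?case by (simp add: U_def act_add_left D.add D'.add)
  qed
  moreover have "vac \<in> U"
    using assms by (simp add: U_def degree_operator_def)
  ultimately have "U = UNIV"
    using vac_generates by (auto simp: generates_def submodule_def)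
  then show ?thesis by (auto simp: U_def)
qed

definition weight_space :: "('l \<Rightarrow> 'g) \<Rightarrow> ('v \<Rightarrow> 'v) \<Rightarrow> ('l \<Rightarrow> int) \<Rightarrow> nat \<Rightarrow> 'v set"
  where "weight_space \<omega> D n r =
    {v. (\<forall>j. act (loop_element (\<omega> j) 0) v = vscale (of_int (n j)) v) \<and> D v = vscale (of_nat r) v}"

text \<open>The coefficient of \<open>x^n\<close> in the multi-parameter character, a power series in \<open>q\<close>.\<close>

definition character_coeff :: "('l \<Rightarrow> 'g) \<Rightarrow> ('v \<Rightarrow> 'v) \<Rightarrow> ('l \<Rightarrow> int) \<Rightarrow> complex fps"
  where "character_coeff \<omega> D n = Abs_fps (\<lambda>r. of_nat (V.dim (weight_space \<omega> D n r)))"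

end

end

theory Submission
  imports Defs
begin

text \<open>For a weight \<open>\<lambda> = \<Sum> n\<^sub>i \<alpha>\<^sub>i\<close> the quantity \<open>r - (\<lambda>, \<lambda>) / 2\<close> is invariant under the affine Weyl group,
  which contains the translations by the root lattice.  The weight spaces of weight \<open>\<lambda>\<close> and degree
  \<open>r + (\<lambda>, \<lambda>) / 2\<close> are therefore all isomorphic to the one of weight \<open>0\<close> and degree \<open>r\<close>.  The proof
  carries this out with only the reflections that are needed.

  For a simple root \<open>\<alpha>\<close> choose root vectors \<open>e\<close>, \<open>f\<close> of weight \<open>\<alpha>\<close>, \<open>-\<alpha>\<close> with \<open>B e f = 1\<close>; then
  \<open>e(m)\<close> and \<open>f(-m)\<close> generate a copy of sl2 whose Cartan element acts by \<open>k = (\<lambda>, \<alpha>) + m\<close> on a weight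
  space.  If both operators are locally nilpotent, then the \<open>k\<close>-th power of \<open>f(-m)\<close> (of \<open>e(m)\<close>, if
  \<open>k\<close> is negative) maps the weight space onto its mirror image (\<open>reflection_bij\<close>, \<open>reflection\<close>).
  The reflection for \<open>m = 0\<close> followed by the one for \<open>m = -1\<close> or \<open>m = 1\<close> is the translation by
  \<open>\<alpha>\<close> or \<open>-\<alpha>\<close> (\<open>translation\<close>), and these generate all translations (\<open>translation_lattice\<close>).

  Local nilpotency is where simple lacing enters.  All roots having square length \<open>2\<close>, root
  vectors satisfy \<open>[e, [e, a]] = -2 B(e, a) e\<close> for every \<open>a\<close> (\<open>root_vector_extremal\<close>).  Hence the
  vector \<open>e(-1) e(-1) 1\<close> is killed by all \<open>a(m)\<close> with \<open>m \<ge> 1\<close>, and irreducibility makes it vanish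
  (\<open>mode_square_vac\<close>); as the adjoint action of \<open>e(m)\<close> is nilpotent, nilpotency spreads from the
  vacuum to the whole module (\<open>locally_nilpotent\<close>).

  That \<open>(\<lambda>, \<lambda>) / 2\<close> is nonnegative needs no positivity of the form: the translations carry the vacuum
  to a nonzero vector of degree \<open>(\<lambda>, \<lambda>) / 2\<close>, and all degrees are nonnegative (\<open>degree_nonneg\<close>).\<close>

section \<open>Weight strings of sl2\<close>

text \<open>Bare operators on a vector space, rather than a module over sl2: the triples used below are pairs
  of affine modes whose Cartan element is shifted by a multiple of the central charge, and the
  symmetry between \<open>e\<close> and \<open>f\<close> becomes a reinterpretation (\<open>swap\<close>).\<close>

locale sl2_action = vector_space scale
  for scale :: "complex \<Rightarrow> 'v::ab_group_add \<Rightarrow> 'v" (infixr \<open>*s\<close> 75) +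
  fixes e f h :: "'v \<Rightarrow> 'v"
  assumes e_add: "e (x + y) = e x + e y" and e_scale: "e (c *s x) = c *s e x"
    and f_add: "f (x + y) = f x + f y" and f_scale: "f (c *s x) = c *s f x"
    and ef: "e (f x) = f (e x) + h x"
    and he: "h (e x) = e (h x) + 2 *s e x"
    and hf: "h (f x) = f (h x) + (- 2) *s f x"
begin

lemma swap: "sl2_action scale f e (\<lambda>x. - h x)"
proof unfold_locales
  fix x :: 'v
  show "f (e x) = e (f x) + - h x" by (simp add: ef)
  have m: "e (- y) = - e y" "f (- y) = - f y" for y
    using e_scale[of "-1" y] f_scale[of "-1" y] by simp_all
  show "- h (f x) = f (- h x) + 2 *s f x" "- h (e x) = e (- h x) + (- 2) *s e x"
    by (simp_all add: hf he m)
qed (simp_all add: e_add f_add e_scale f_scale)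

lemma weight_f:
  assumes "h v = k *s v"
  shows "h ((f ^^ j) v) = (k - 2 * of_nat j) *s (f ^^ j) v"
proof (induction j)
  case (Suc j)
  have "h ((f ^^ Suc j) v) = ((k - 2 * of_nat j) + (- 2)) *s (f ^^ Suc j) v"
    unfolding scale_left_distrib by (simp add: hf f_scale Suc)
  then show ?case by (simp add: algebra_simps)
qed (simp add: assms)

lemma e_f_power:
  assumes "h v = k *s v"
  shows "e ((f ^^ Suc j) v) =
    (f ^^ Suc j) (e v) + (of_nat (Suc j) * (k - of_nat j)) *s (f ^^ j) v"
proof (induction j)
  case 0
  then show ?case by (simp add: ef assms)
next
  case (Suc j)
  have "e ((f ^^ Suc (Suc j)) v) = f (e ((f ^^ Suc j) v)) + h ((f ^^ Suc j) v)"
    by (simp add: ef)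
  also have "\<dots> = (f ^^ Suc (Suc j)) (e v) + (of_nat (Suc j) * (k - of_nat j) + (k - 2 * of_nat (Suc j))) *s (f ^^ Suc j) v"
    unfolding Suc weight_f[OF assms] scale_left_distrib by (simp add: f_add f_scale add.assoc)
  also have "of_nat (Suc j) * (k - of_nat j) + (k - 2 * of_nat (Suc j)) =
      of_nat (Suc (Suc j)) * (k - of_nat (Suc j))"
    by (simp add: algebra_simps)
  finally show ?case .
qed

lemma e_power_f:
  assumes "h v = k *s v"
  shows "(e ^^ Suc j) (f v) =
    f ((e ^^ Suc j) v) + (of_nat (Suc j) * (k + of_nat j)) *s (e ^^ j) v"
proof -
  interpret s: sl2_action scale f e "\<lambda>x. - h x" by (rule swap)
  have "f ((e ^^ Suc j) v) = (e ^^ Suc j) (f v) + (of_nat (Suc j) * (- k - of_nat j)) *s (e ^^ j) v"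
    by (rule s.e_f_power) (simp add: assms)
  moreover have "of_nat (Suc j) * (- k - of_nat j) = - (of_nat (Suc j) * (k + of_nat j))"
    by (simp add: algebra_simps)
  ultimately show ?thesis by (simp only: scale_minus_left) simp
qed

lemma zero: "e 0 = 0" "f 0 = 0"
  using e_add[of 0 0] f_add[of 0 0] by simp_all

lemma power_linear: "(e ^^ j) (x + y) = (e ^^ j) x + (e ^^ j) y" "(e ^^ j) (c *s x) = c *s (e ^^ j) x"
  "(e ^^ j) 0 = 0"
  by (induction j) (simp_all add: e_add e_scale zero)

text \<open>On the vectors of weight \<open>k\<close> killed by the power \<open>N + 1\<close> of \<open>e\<close>, the operator \<open>f e\<close> has the
  eigenvalue \<open>N (k + N + 1) \<ge> 0\<close> modulo those already killed by the power \<open>N\<close>.  It is thus triangular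
  with nonnegative eigenvalues, and becomes invertible when a positive number is added.\<close>

lemma shifted_bij:
  assumes X: "subspace X" and stable: "\<And>x. x \<in> X \<Longrightarrow> f (e x) \<in> X"
    and weight: "\<And>x. x \<in> X \<Longrightarrow> h x = of_nat k *s x"
    and nil: "\<And>x. x \<in> X \<Longrightarrow> \<exists>N. (e ^^ N) x = 0"
    and pos: "a > 0"
  shows "bij_betw (\<lambda>x. f (e x) + of_nat a *s x) X X"
proof -
  let ?K = "\<lambda>x. f (e x) + of_nat a *s x"
  have K_diff: "?K (x - y) = ?K x - ?K y" for x y
  proof -
    have "?K ((x - y) + y) = ?K (x - y) + ?K y"
      by (simp only: e_add f_add scale_right_distrib) (simp add: algebra_simps)
    then show ?thesis by simp
  qed
  have top: "(e ^^ N) (f (e x)) = of_nat (N * (k + N + 1)) *s (e ^^ N) x"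
    if "x \<in> X" "(e ^^ Suc N) x = 0" for x N
  proof (cases N)
    case 0
    then show ?thesis using that by (simp add: zero)
  next
    case (Suc j)
    have "h (e x) = (of_nat k + 2) *s e x"
      by (simp add: he weight[OF that(1)] e_scale scale_left_distrib)
    from e_power_f[OF this, of j]
    have "(e ^^ Suc j) (f (e x)) = (of_nat (Suc j) * (of_nat k + 2 + of_nat j)) *s (e ^^ j) (e x)"
      using that(2) unfolding Suc by (simp only: funpow_Suc_right o_apply zero) simp
    moreover have "of_nat (Suc j) * (of_nat k + 2 + of_nat j) = (of_nat (N * (k + N + 1)) :: complex)"
      by (simp add: Suc algebra_simps)
    ultimately show ?thesis unfolding Suc by (simp only: funpow_Suc_right o_apply)
  qed
  have inj: "x = 0" if "x \<in> X" "?K x = 0" for x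
  proof (rule ccontr)
    assume "x \<noteq> 0"
    define N where "N = (LEAST N. (e ^^ N) x = 0)"
    have N: "(e ^^ N) x = 0"
      unfolding N_def using nil[OF that(1)] by (rule LeastI_ex)
    then obtain M where M: "N = Suc M"
      using \<open>x \<noteq> 0\<close> by (cases N) auto
    have nz: "(e ^^ M) x \<noteq> 0"
      using not_less_Least[of M "\<lambda>N. (e ^^ N) x = 0"] M N_def by auto
    have "0 = (e ^^ M) (?K x)" by (simp add: that power_linear)
    also have "\<dots> = of_nat (M * (k + M + 1) + a) *s (e ^^ M) x"
      using N M top[OF that(1)] by (simp only: power_linear of_nat_add scale_left_distrib)
    finally have "of_nat (M * (k + M + 1) + a) *s (e ^^ M) x = 0" by simp
    then have "M * (k + M + 1) + a = 0"
      unfolding scale_eq_0_iff of_nat_eq_0_iff using nz by simp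
    with pos show False by simp
  qed
  have surj: "\<exists>y\<in>X. ?K y = x" if "x \<in> X" "(e ^^ N) x = 0" for N x
    using that
  proof (induction N arbitrary: x)
    case 0
    then show ?case using subspace_0[OF X] by (auto simp: zero intro!: bexI[of _ 0])
  next
    case (Suc N)
    \<comment> \<open>Subtracting the eigenvalue lowers the nilpotency order, and the remainder has a preimage.\<close>
    let ?b = "N * (k + N + 1)"
    define x' where "x' = f (e x) - of_nat ?b *s x"
    have "x' \<in> X"
      unfolding x'_def by (intro subspace_diff[OF X] subspace_scale[OF X] stable Suc.prems)
    moreover have "(e ^^ N) x' = 0"
    proof -
      have "(e ^^ N) (x' + of_nat ?b *s x) = (e ^^ N) x' + of_nat ?b *s (e ^^ N) x"
        by (simp only: power_linear)
      then show ?thesis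
        using top[OF Suc.prems] by (simp add: x'_def)
    qed
    ultimately obtain y where y: "y \<in> X" "?K y = x'" using Suc.IH by blast
    define d :: complex where "d = of_nat (a + ?b)"
    have ne: "d \<noteq> 0" using pos unfolding d_def of_nat_eq_0_iff by simp
    have "?K (x - y) = d *s x"
      unfolding d_def K_diff y(2) x'_def by (simp only: of_nat_add scale_left_distrib) simp
    moreover have "?K (inverse d *s (x - y)) = inverse d *s ?K (x - y)"
      by (simp only: e_scale f_scale scale_right_distrib scale_left_commute)
    ultimately have "?K (inverse d *s (x - y)) = x"
      using ne by (simp only: scale_scale) simp
    moreover have "inverse d *s (x - y) \<in> X"
      by (intro subspace_scale[OF X] subspace_diff[OF X] Suc.prems y)
    ultimately show ?case by blast
  qed
  show ?thesis
  proof (rule bij_betw_imageI)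
    show "inj_on ?K X"
    proof (rule inj_onI)
      fix x y assume "x \<in> X" "y \<in> X" "?K x = ?K y"
      then show "x = y"
        using inj[of "x - y"] K_diff[of x y] subspace_diff[OF X] by simp
    qed
    show "?K ` X = X"
    proof
      show "?K ` X \<subseteq> X" by (auto intro!: stable subspace_add[OF X] subspace_scale[OF X])
      show "X \<subseteq> ?K ` X" using surj nil by (metis (no_types, lifting) image_eqI subsetI)
    qed
  qed
qed

text \<open>By \<open>e_f_power\<close>, the operator is the product of the \<open>f e + (i + 1) (k - i)\<close> for \<open>i < j\<close>, all of them
  invertible by \<open>shifted_bij\<close>.\<close>

lemma e_power_f_power_bij:
  assumes X: "subspace X" and stable: "\<And>x. x \<in> X \<Longrightarrow> f (e x) \<in> X"
    and weight: "\<And>x. x \<in> X \<Longrightarrow> h x = of_nat k *s x"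
    and nil: "\<And>x. x \<in> X \<Longrightarrow> \<exists>N. (e ^^ N) x = 0"
    and "j \<le> k"
  shows "bij_betw (\<lambda>x. (e ^^ j) ((f ^^ j) x)) X X"
  using \<open>j \<le> k\<close>
proof (induction j)
  case 0
  show ?case by (simp add: bij_betw_def)
next
  case (Suc j)
  define a where "a = Suc j * (k - j)"
  have "a > 0" using Suc.prems by (simp add: a_def)
  have a: "of_nat (Suc j) * (of_nat k - of_nat j) = (of_nat a :: complex)"
    using Suc.prems unfolding a_def of_nat_mult by (simp only: of_nat_diff Suc_leD)
  interpret s: sl2_action scale f e "\<lambda>x. - h x" by (rule swap)
  have "(e ^^ Suc j) ((f ^^ Suc j) x) = (e ^^ j) ((f ^^ j) (f (e x) + of_nat a *s x))" if "x \<in> X" for x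
    using e_f_power[OF weight[OF that], of j]
    by (simp only: funpow_Suc_right o_apply s.power_linear a)
  moreover have "bij_betw (\<lambda>x. (e ^^ j) ((f ^^ j) (f (e x) + of_nat a *s x))) X X"
    using bij_betw_trans[OF shifted_bij[OF X stable weight nil \<open>a > 0\<close>] Suc.IH] Suc.prems
    by (simp add: o_def)
  ultimately show ?case
    by (metis (no_types, lifting) bij_betw_cong)
qed

text \<open>One of the two compositions of the powers of \<open>e\<close> and \<open>f\<close> gives injectivity, the other one, with
  the roles of \<open>e\<close> and \<open>f\<close> exchanged, surjectivity.\<close>

theorem reflection_bij:
  assumes X: "subspace X" "\<And>x. x \<in> X \<Longrightarrow> f (e x) \<in> X" "\<And>x. x \<in> X \<Longrightarrow> h x = of_nat k *s x"
    "\<And>x. x \<in> X \<Longrightarrow> \<exists>N. (e ^^ N) x = 0"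
    and Y: "subspace Y" "\<And>y. y \<in> Y \<Longrightarrow> e (f y) \<in> Y" "\<And>y. y \<in> Y \<Longrightarrow> h y = - of_nat k *s y"
    "\<And>y. y \<in> Y \<Longrightarrow> \<exists>N. (f ^^ N) y = 0"
    and fX: "\<And>x. x \<in> X \<Longrightarrow> (f ^^ k) x \<in> Y" and eY: "\<And>y. y \<in> Y \<Longrightarrow> (e ^^ k) y \<in> X"
  shows "bij_betw (f ^^ k) X Y"
proof -
  interpret s: sl2_action scale f e "\<lambda>x. - h x" by (rule swap)
  have 1: "bij_betw (\<lambda>x. (e ^^ k) ((f ^^ k) x)) X X"
    by (rule e_power_f_power_bij[OF X order_refl])
  have 2: "bij_betw (\<lambda>y. (f ^^ k) ((e ^^ k) y)) Y Y"
    by (rule s.e_power_f_power_bij[OF Y(1,2) _ Y(4) order_refl]) (simp_all add: Y(3))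
  show ?thesis
  proof (rule bij_betw_imageI)
    show "inj_on (f ^^ k) X"
      using bij_betw_imp_inj_on[OF 1] by (auto simp: inj_on_def)
    have "Y = (\<lambda>y. (f ^^ k) ((e ^^ k) y)) ` Y"
      using bij_betw_imp_surj_on[OF 2] by simp
    also have "\<dots> \<subseteq> (f ^^ k) ` X" using eY by auto
    finally show "(f ^^ k) ` X = Y" using fX by auto
  qed
qed

end

section \<open>Eigenvectors and traces\<close>

context vector_space
begin

text \<open>In the infinite-dimensional case both sides are the default value \<open>0\<close>.\<close>

lemma linear_iso_dim:
  assumes T: "Vector_Spaces.linear scale scale T" and bij: "bij_betw T X Y" and X: "subspace X"
  shows "dim X = dim Y"
proof -
  interpret T: Vector_Spaces.linear scale scale T by (rule T)
  obtain b where b: "b \<subseteq> X" "independent b" "X \<subseteq> span b" "card b = dim X"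
    using basis_exists by blast
  have Xb: "X = span b" using b X by (simp add: span_subspace)
  have inj: "inj_on T (span b)" using bij Xb by (simp add: bij_betw_def)
  have Y: "Y = span (T ` b)" using bij by (simp add: bij_betw_def Xb T.span_image)
  have "independent (T ` b)" using T.independent_injective_image b(2) inj by blast
  moreover have "span (T ` b) = span Y" by (simp add: Y span_span)
  ultimately have "dim Y = card (T ` b)" by (metis dim_eq_card)
  also have "\<dots> = card b" using inj by (meson card_image inj_on_subset span_superset)
  finally show ?thesis using b by simp
qed

text \<open>The operator \<open>T - c\<close> removes the component for \<open>c\<close> and multiplies every other one by a nonzero
  difference of eigenvalues, which allows induction on the number of components.\<close>

lemma eigen_components_in_stable_subspace:
  assumes T: "Vector_Spaces.linear scale scale T" and W: "subspace W"
    and stable: "\<And>x. x \<in> W \<Longrightarrow> T x \<in> W"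
    and fin: "finite M" and eig: "\<And>m. m \<in> M \<Longrightarrow> T (y m) = scale m (y m)"
    and sum: "(\<Sum>m\<in>M. y m) \<in> W"
  shows "m \<in> M \<Longrightarrow> y m \<in> W"
  using fin eig sum
proof (induction M arbitrary: y m)
  case (insert c M)
  interpret T: Vector_Spaces.linear scale scale T by (rule T)
  let ?x = "\<Sum>m\<in>insert c M. y m"
  have eq: "T ?x - scale c ?x = (\<Sum>m\<in>M. scale (m - c) (y m))"
  proof -
    have "T ?x = scale c (y c) + (\<Sum>m\<in>M. scale m (y m))"
      using insert.hyps insert.prems(2) by (simp add: T.add T.sum)
    then show ?thesis
      using insert(1,2) by (simp only: sum.insert scale_right_distrib scale_sum_right
          scale_left_diff_distrib sum_subtractf) simp
  qed
  have "T ?x - scale c ?x \<in> W"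
    by (intro subspace_diff[OF W] subspace_scale[OF W] stable insert.prems)
  have inM: "scale (m - c) (y m) \<in> W" if "m \<in> M" for m
  proof (rule insert.IH[OF that])
    show "T (scale (m - c) (y m)) = scale m (scale (m - c) (y m))" if "m \<in> M" for m
      using insert.prems(2)[of m] that by (simp add: T.scale mult.commute)
    show "(\<Sum>m\<in>M. scale (m - c) (y m)) \<in> W"
      using \<open>T ?x - scale c ?x \<in> W\<close> unfolding eq .
  qed
  have M: "y m \<in> W" if "m \<in> M" for m
  proof -
    have "m - c \<noteq> 0" using that insert.hyps by auto
    then have "scale (inverse (m - c)) (scale (m - c) (y m)) = y m"
      by simp
    then show ?thesis using subspace_scale[OF W inM[OF that], of "inverse (m - c)"] by simp
  qed
  moreover have "y c \<in> W"
  proof -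
    have "y c = ?x - (\<Sum>m\<in>M. y m)" using insert.hyps by simp
    also have "\<dots> \<in> W" by (intro subspace_diff[OF W] subspace_sum[OF W] insert.prems M)
    finally show ?thesis .
  qed
  ultimately show ?case using insert.prems(1) by auto
qed simp

lemma span_eigenvectors:
  assumes T: "Vector_Spaces.linear scale scale T"
    and "x \<in> span {x. \<exists>c\<in>S. T x = scale c x}"
  obtains M y where "finite M" "M \<subseteq> S" "\<And>m. T (y m) = scale m (y m)" "\<And>m. m \<notin> M \<Longrightarrow> y m = 0"
    "x = (\<Sum>m\<in>M. y m)"
proof -
  interpret T: Vector_Spaces.linear scale scale T by (rule T)
  have "\<exists>M y. finite M \<and> M \<subseteq> S \<and> (\<forall>m. T (y m) = scale m (y m)) \<and> (\<forall>m. m \<notin> M \<longrightarrow> y m = 0) \<and>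
      x = (\<Sum>m\<in>M. y m)"
    using assms(2)
  proof (induction rule: span_induct_alt)
    case base
    show ?case by (rule exI[of _ "{}"], rule exI[of _ "\<lambda>_. 0"]) (simp add: T.zero)
  next
    case (step c v w)
    then obtain d M y where d: "d \<in> S" "T v = scale d v" and y: "finite M" "M \<subseteq> S"
      "\<forall>m. T (y m) = scale m (y m)" "\<forall>m. m \<notin> M \<longrightarrow> y m = 0" "w = (\<Sum>m\<in>M. y m)"
      by blast
    let ?z = "\<lambda>m. if m = d then scale c v else 0"
    have "w = (\<Sum>m\<in>insert d M. y m)"
      unfolding y(5) using y by (intro sum.mono_neutral_left) auto
    then have "scale c v + w = (\<Sum>m\<in>insert d M. ?z m + y m)"
      using y(1) by (simp add: sum.distrib)
    moreover have "T (?z m + y m) = scale m (?z m + y m)" for m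
      using y(3) d by (auto simp: T.add T.scale T.zero scale_right_distrib)
    ultimately show ?case using y d
      by (intro exI[of _ "insert d M"] exI[of _ "\<lambda>m. ?z m + y m"]) auto
  qed
  then show thesis using that by blast
qed

lemma eigenvector_outside_spectrum:
  assumes T: "Vector_Spaces.linear scale scale T"
    and v: "T v = scale c v" "v \<in> span {x. \<exists>c\<in>S. T x = scale c x}" and "c \<notin> S"
  shows "v = 0"
proof -
  interpret T: Vector_Spaces.linear scale scale T by (rule T)
  obtain M y where y: "finite M" "M \<subseteq> S" "\<And>m. T (y m) = scale m (y m)" "v = (\<Sum>m\<in>M. y m)"
    using span_eigenvectors[OF T v(2)] by metis
  \<comment> \<open>Moving \<open>v\<close> to the other side turns the decomposition into one of \<open>0\<close>, which lies in \<open>{0}\<close>.\<close>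
  define z where "z = y(c := - v)"
  have "c \<notin> M" using y(2) assms(4) by auto
  then have "(\<Sum>m\<in>M. z m) = v" unfolding y(4) z_def by (intro sum.cong) auto
  then have "(\<Sum>m\<in>insert c M. z m) \<in> {0}"
    using y(1) \<open>c \<notin> M\<close> by (simp add: z_def)
  moreover have "T (z m) = scale m (z m)" for m
    using y(3) v(1) by (auto simp: z_def T.neg)
  ultimately have "z c \<in> {0}"
    using eigen_components_in_stable_subspace[OF T subspace_single_0, of "insert c M" z c] y(1)
    by (simp add: T.zero)
  then show ?thesis by (simp add: z_def)
qed

lemma stable_subspace_diagonalizable:
  assumes T: "Vector_Spaces.linear scale scale T" and diag: "span {x. \<exists>c. T x = scale c x} = UNIV"
    and W: "subspace W" and stable: "\<And>x. x \<in> W \<Longrightarrow> T x \<in> W"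
  shows "W \<subseteq> span {x \<in> W. \<exists>c. T x = scale c x}"
proof
  fix x assume x: "x \<in> W"
  have "x \<in> span {x. \<exists>c\<in>UNIV. T x = scale c x}" using diag by simp
  from span_eigenvectors[OF T this] obtain M y
    where y: "finite M" "\<And>m. T (y m) = scale m (y m)" "x = (\<Sum>m\<in>M. y m)"
    by (metis (no_types))
  have "y m \<in> W" if "m \<in> M" for m
    using eigen_components_in_stable_subspace[OF T W stable y(1,2) _ that] x y(3) by blast
  then show "x \<in> span {x \<in> W. \<exists>c. T x = scale c x}"
    unfolding y(3) using y(2) by (intro span_sum span_base) auto
qed

end

context lie_algebra
begin

lemma bracket_zero: "\<lbrakk>0, x\<rbrakk> = 0" "\<lbrakk>x, 0\<rbrakk> = 0"
  using bracket_add_left[of 0 0 x] bracket_add_right[of x 0 0] by simp_all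

lemma bracket_anti: "\<lbrakk>x, y\<rbrakk> = - \<lbrakk>y, x\<rbrakk>"
  using bracket_self[of "x + y"] unfolding bracket_add_left bracket_add_right
  by (simp add: bracket_self eq_neg_iff_add_eq_0 add.commute)

lemma bracket_minus: "\<lbrakk>- x, y\<rbrakk> = - \<lbrakk>x, y\<rbrakk>" "\<lbrakk>x, - y\<rbrakk> = - \<lbrakk>x, y\<rbrakk>"
  using bracket_scale_left[of "-1" x y] bracket_scale_right[of x "-1" y] by simp_all

lemma jacobi_left: "\<lbrakk>\<lbrakk>x, y\<rbrakk>, z\<rbrakk> = \<lbrakk>x, \<lbrakk>y, z\<rbrakk>\<rbrakk> - \<lbrakk>y, \<lbrakk>x, z\<rbrakk>\<rbrakk>"
proof -
  have "\<lbrakk>x, \<lbrakk>y, z\<rbrakk>\<rbrakk> + - \<lbrakk>y, \<lbrakk>x, z\<rbrakk>\<rbrakk> + - \<lbrakk>\<lbrakk>x, y\<rbrakk>, z\<rbrakk> = 0"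
    using jacobi[of x y z] bracket_anti[of "\<lbrakk>x, y\<rbrakk>" z] bracket_anti[of z x] by (simp add: bracket_minus)
  then show ?thesis by simp
qed

lemma linear_ad: "Vector_Spaces.linear (*s) (*s) (\<lambda>y. \<lbrakk>x, y\<rbrakk>)"
  by (simp add: Vector_Spaces.linear_iff vector_space_axioms bracket_add_right bracket_scale_right)

context
  assumes finite_dim: finite_dim
begin

text \<open>The trace is computed in \<open>extend_basis {}\<close>, whose finiteness is what makes the sum meaningful.\<close>

lemma trace_basis: "independent (extend_basis {})" "span (extend_basis {}) = UNIV" "finite (extend_basis {})"
proof -
  show "independent (extend_basis {})" "span (extend_basis {}) = UNIV"
    by (simp_all add: independent_extend_basis independent_empty)
  then show "finite (extend_basis {})"
    using finite_dim independent_span_bound unfolding finite_dim_def by (metis subset_UNIV)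
qed

lemma trace_linear:
  "linear_trace (\<lambda>z. f z + g z) = linear_trace f + linear_trace g"
  "linear_trace (\<lambda>z. c *s f z) = c * linear_trace f"
  "linear_trace (\<lambda>z. f z - g z) = linear_trace f - linear_trace g"
  by (simp_all add: linear_trace_def representation_add representation_scale representation_diff trace_basis
      sum.distrib sum_distrib_left sum_subtractf)

lemma trace_commute:
  assumes f: "Vector_Spaces.linear (*s) (*s) f" and g: "Vector_Spaces.linear (*s) (*s) g"
  shows "linear_trace (\<lambda>z. f (g z)) = linear_trace (\<lambda>z. g (f z))"
proof -
  let ?E = "extend_basis {}" and ?r = "representation (extend_basis {})"
  have expand: "?r (f v) b = (\<Sum>c\<in>?E. ?r v c * ?r (f c) b)"
    if f: "Vector_Spaces.linear (*s) (*s) f" for f v b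
  proof -
    interpret f: Vector_Spaces.linear "(*s)" "(*s)" f by (rule f)
    interpret r: Vector_Spaces.linear "(*s)" "(*)" "\<lambda>v. ?r v b"
      by (rule linear_representation) (rule trace_basis)+
    have "v = (\<Sum>c\<in>?E. ?r v c *s c)"
      by (rule sum_representation_eq[symmetric]) (simp_all add: trace_basis)
    then have "?r (f v) b = ?r (f (\<Sum>c\<in>?E. ?r v c *s c)) b" by simp
    also have "\<dots> = (\<Sum>c\<in>?E. ?r v c * ?r (f c) b)"
      by (simp only: f.sum f.scale r.sum r.scale)
    finally show ?thesis .
  qed
  show ?thesis
    unfolding linear_trace_def
    by (subst expand[OF f], subst expand[OF g], subst sum.swap) (simp only: mult.commute)
qed

lemma killing_form_bilinear:
  "killing_form (x + y) z = killing_form x z + killing_form y z"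
  "killing_form (c *s x) z = c * killing_form x z"
  by (simp_all add: killing_form_def bracket_add_left bracket_scale_left trace_linear)

lemma killing_form_commute: "killing_form x y = killing_form y x"
  unfolding killing_form_def by (rule trace_commute) (rule linear_ad)+

lemma killing_form_invariant: "killing_form \<lbrakk>x, y\<rbrakk> z = killing_form x \<lbrakk>y, z\<rbrakk>"
proof -
  have lin: "Vector_Spaces.linear (*s) (*s) (\<lambda>w. \<lbrakk>x, \<lbrakk>z, w\<rbrakk>\<rbrakk>)"
    by (simp add: Vector_Spaces.linear_iff vector_space_axioms bracket_add_right bracket_scale_right)
  show ?thesis
    using trace_commute[OF linear_ad lin, of y]
    by (simp add: killing_form_def jacobi_left bracket_add_right trace_linear
        linear_ad[THEN Vector_Spaces.linear.axioms(3), THEN module_hom.diff])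
qed

end

end

section \<open>Roots of a simply-laced simple Lie algebra\<close>

locale root_datum = lie_algebra scale bracket
  for scale :: "complex \<Rightarrow> 'g::ab_group_add \<Rightarrow> 'g" (infixr \<open>*s\<close> 75)
    and bracket :: "'g \<Rightarrow> 'g \<Rightarrow> 'g" (\<open>\<lbrakk>_, _\<rbrakk>\<close>) +
  fixes H :: "'g set"
    and \<alpha> :: "'l::finite \<Rightarrow> 'g \<Rightarrow> complex"
    and \<omega> :: "'l \<Rightarrow> 'g"
    and B :: "'g \<Rightarrow> 'g \<Rightarrow> complex"
  assumes finite_dim: finite_dim
    and simple: simple
    and cartan: "cartan_subalgebra H"
    and rank: "dim H = CARD('l)"
    and simple_roots: "simple_roots H \<alpha>"
    and normalized: "normalized_killing_form H B"
    and coweights: "fundamental_coweights H \<alpha> \<omega>"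
begin

lemma subspace_H: "subspace H"
  and H_abelian: "h \<in> H \<Longrightarrow> h' \<in> H \<Longrightarrow> \<lbrakk>h, h'\<rbrakk> = 0"
  and H_centralizer: "(\<And>h. h \<in> H \<Longrightarrow> \<lbrakk>h, x\<rbrakk> = 0) \<Longrightarrow> x \<in> H"
  and H_diagonalizable: "h \<in> H \<Longrightarrow> span {x. \<exists>c. \<lbrakk>h, x\<rbrakk> = c *s x} = UNIV"
  using cartan unfolding cartan_subalgebra_def diagonalizable_def by blast+

lemma coweight: "\<omega> j \<in> H" "\<alpha> i (\<omega> j) = (if i = j then 1 else 0)"
  using coweights by (auto simp: fundamental_coweights_def)

lemma simple_root: "\<alpha> i \<in> roots H"
  using simple_roots by (simp add: simple_roots_def)

lemma dual_space_add: "\<gamma> \<in> dual_space H \<Longrightarrow> x \<in> H \<Longrightarrow> y \<in> H \<Longrightarrow> \<gamma> (x + y) = \<gamma> x + \<gamma> y"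
  and dual_space_scale: "\<gamma> \<in> dual_space H \<Longrightarrow> x \<in> H \<Longrightarrow> \<gamma> (c *s x) = c * \<gamma> x"
  and dual_space_outside: "\<gamma> \<in> dual_space H \<Longrightarrow> x \<notin> H \<Longrightarrow> \<gamma> x = 0"
  by (simp_all add: dual_space_def)

lemma dual_space_eqI:
  "\<gamma> \<in> dual_space H \<Longrightarrow> \<delta> \<in> dual_space H \<Longrightarrow> (\<And>h. h \<in> H \<Longrightarrow> \<gamma> h = \<delta> h) \<Longrightarrow> \<gamma> = \<delta>"
  using dual_space_outside by (metis ext)

lemma dual_space_closed:
  "\<gamma> \<in> dual_space H \<Longrightarrow> \<delta> \<in> dual_space H \<Longrightarrow> (\<lambda>x. \<gamma> x + \<delta> x) \<in> dual_space H"
  "\<gamma> \<in> dual_space H \<Longrightarrow> (\<lambda>x. - \<gamma> x) \<in> dual_space H"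
  "(\<lambda>x. 0) \<in> dual_space H"
  by (simp_all add: dual_space_def algebra_simps)

lemma root_in_dual: "\<gamma> \<in> roots H \<Longrightarrow> \<gamma> \<in> dual_space H"
  by (simp add: roots_def)

lemma dual_space_sum:
  assumes "\<gamma> \<in> dual_space H"
  shows "\<gamma> (\<Sum>j\<in>J. c j *s \<omega> j) = (\<Sum>j\<in>J. c j * \<gamma> (\<omega> j))"
proof (induction J rule: infinite_finite_induct)
  case (insert j J)
  then show ?case
    by (simp add: dual_space_add[OF assms] dual_space_scale[OF assms] coweight subspace_sum
        subspace_scale subspace_H)
qed (use dual_space_scale[OF assms subspace_0[OF subspace_H], of 0] in simp_all)

lemma coweight_expansion:
  assumes "h \<in> H"
  shows "h = (\<Sum>j\<in>UNIV. \<alpha> j h *s \<omega> j)"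
proof -
  have inj: "inj \<omega>"
    using coweight(2) by (metis injI zero_neq_one)
  have coeff: "\<alpha> i (\<Sum>j\<in>UNIV. c j *s \<omega> j) = c i" for c i
    by (simp add: dual_space_sum[OF root_in_dual[OF simple_root]] coweight if_distrib cong: if_cong)
  have "independent (range \<omega>)"
  proof (subst dependent_finite)
    have "u v = 0" if sum: "(\<Sum>v\<in>range \<omega>. u v *s v) = 0" and v: "v \<in> range \<omega>" for u v
    proof -
      obtain i where i: "v = \<omega> i" using v by auto
      have "(\<Sum>j\<in>UNIV. u (\<omega> j) *s \<omega> j) = 0"
        using sum by (simp add: sum.reindex[OF inj])
      then show ?thesis using coeff[of i "\<lambda>j. u (\<omega> j)"] coeff[of i "\<lambda>j. 0"] i by simp
    qed
    then show "\<not> (\<exists>u. (\<exists>v\<in>range \<omega>. u v \<noteq> 0) \<and> (\<Sum>v\<in>range \<omega>. u v *s v) = 0)" by blast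
  qed simp
  moreover interpret finite_dimensional_vector_space scale "extend_basis {}"
    by unfold_locales (rule trace_basis[OF finite_dim])+
  have "card (range \<omega>) = dim H" by (simp add: rank card_image inj)
  ultimately have "H \<subseteq> span (range \<omega>)"
    using coweight by (intro card_ge_dim_independent) auto
  then have "h \<in> span (range \<omega>)" using assms by blast
  then obtain u where "h = (\<Sum>v\<in>range \<omega>. u v *s v)"
    using span_finite[of "range \<omega>"] by auto
  then have h: "h = (\<Sum>j\<in>UNIV. u (\<omega> j) *s \<omega> j)"
    by (simp add: sum.reindex[OF inj])
  show ?thesis using coeff[of _ "\<lambda>j. u (\<omega> j)"] h by simp
qed

lemma root_spaceD: "x \<in> root_space H \<gamma> \<Longrightarrow> h \<in> H \<Longrightarrow> \<lbrakk>h, x\<rbrakk> = \<gamma> h *s x"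
  by (simp add: root_space_def)

lemma root_space_zero: "root_space H (\<lambda>_. 0) = H"
  using H_centralizer H_abelian by (auto simp: root_space_def)

text \<open>Simultaneous diagonalization of the commuting operators given by the coweights, one at a time:
  each preserves the joint eigenspaces of the earlier ones.  Since the coweights span \<open>H\<close>, a joint
  eigenvector for them is a root vector or lies in \<open>H\<close>.\<close>

lemma root_space_decomposition: "span (\<Union>\<gamma>\<in>dual_space H. root_space H \<gamma>) = UNIV"
proof -
  have joint: "span {x. \<forall>j\<in>J. \<exists>c. \<lbrakk>\<omega> j, x\<rbrakk> = c *s x} = UNIV" if "finite J" for J
    using that
  proof (induction J)
    case (insert j J)
    let ?S = "{x. \<forall>j\<in>insert j J. \<exists>c. \<lbrakk>\<omega> j, x\<rbrakk> = c *s x}"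
    have "x \<in> span ?S" if x: "\<forall>j\<in>J. \<exists>c. \<lbrakk>\<omega> j, x\<rbrakk> = c *s x" for x
    proof -
      obtain c where c: "\<And>i. i \<in> J \<Longrightarrow> \<lbrakk>\<omega> i, x\<rbrakk> = c i *s x" using x by metis
      define W where "W = {y. \<forall>i\<in>J. \<lbrakk>\<omega> i, y\<rbrakk> = c i *s y}"
      have W: "subspace W"
        by (rule subspaceI) (auto simp: W_def bracket_zero bracket_add_right bracket_scale_right
            scale_right_distrib mult.commute)
      have "\<lbrakk>\<omega> j, y\<rbrakk> \<in> W" if "y \<in> W" for y
      proof -
        have "\<lbrakk>\<omega> i, \<lbrakk>\<omega> j, y\<rbrakk>\<rbrakk> = \<lbrakk>\<omega> j, \<lbrakk>\<omega> i, y\<rbrakk>\<rbrakk>" for i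
          using jacobi_left[of "\<omega> i" "\<omega> j" y] by (simp add: H_abelian coweight bracket_zero)
        then show ?thesis using that by (simp add: W_def bracket_scale_right)
      qed
      then have "W \<subseteq> span {x \<in> W. \<exists>c. \<lbrakk>\<omega> j, x\<rbrakk> = c *s x}"
        by (rule stable_subspace_diagonalizable[OF linear_ad H_diagonalizable[OF coweight(1)] W])
      also have "\<dots> \<subseteq> span ?S" by (rule span_mono) (auto simp: W_def)
      finally show ?thesis using c by (auto simp: W_def)
    qed
    then have "span {x. \<forall>j\<in>J. \<exists>c. \<lbrakk>\<omega> j, x\<rbrakk> = c *s x} \<subseteq> span ?S"
      by (intro span_minimal) auto
    then show ?case using insert.IH by auto
  qed simp
  have "{x. \<forall>j\<in>UNIV. \<exists>c. \<lbrakk>\<omega> j, x\<rbrakk> = c *s x} \<subseteq> (\<Union>\<gamma>\<in>dual_space H. root_space H \<gamma>)"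
  proof
    fix x assume "x \<in> {x. \<forall>j\<in>UNIV. \<exists>c. \<lbrakk>\<omega> j, x\<rbrakk> = c *s x}"
    then obtain c where c: "\<And>j. \<lbrakk>\<omega> j, x\<rbrakk> = c j *s x" by simp metis
    define \<gamma> where "\<gamma> h = (if h \<in> H then \<Sum>j\<in>UNIV. c j * \<alpha> j h else 0)" for h
    have "\<gamma> \<in> dual_space H"
      unfolding dual_space_def \<gamma>_def
      by (simp add: subspace_add subspace_scale subspace_H dual_space_add dual_space_scale
          root_in_dual simple_root distrib_left sum.distrib sum_distrib_left mult.left_commute)
    moreover have "\<lbrakk>h, x\<rbrakk> = \<gamma> h *s x" if "h \<in> H" for h
    proof -
      have "Vector_Spaces.linear (*s) (*s) (\<lambda>h. \<lbrakk>h, x\<rbrakk>)"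
        by (simp add: Vector_Spaces.linear_iff vector_space_axioms bracket_add_left bracket_scale_left)
      then interpret l: Vector_Spaces.linear "(*s)" "(*s)" "\<lambda>h. \<lbrakk>h, x\<rbrakk>" .
      have "\<lbrakk>h, x\<rbrakk> = \<lbrakk>\<Sum>j\<in>UNIV. \<alpha> j h *s \<omega> j, x\<rbrakk>"
        using coweight_expansion[OF that] by simp
      also have "\<dots> = \<gamma> h *s x"
        by (simp add: l.sum l.scale c \<gamma>_def that scale_sum_left mult.commute)
      finally show ?thesis .
    qed
    ultimately show "x \<in> (\<Union>\<gamma>\<in>dual_space H. root_space H \<gamma>)"
      by (auto simp: root_space_def)
  qed
  from span_mono[OF this] show ?thesis using joint[of UNIV] by auto
qed

lemma root_space_induct:
  assumes "subspace W" "\<And>\<gamma> x. \<gamma> \<in> dual_space H \<Longrightarrow> x \<in> root_space H \<gamma> \<Longrightarrow> x \<in> W"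
  shows "x \<in> W"
proof -
  have "span (\<Union>\<gamma>\<in>dual_space H. root_space H \<gamma>) \<subseteq> W"
    using assms by (intro span_minimal) auto
  then show ?thesis by (auto simp: root_space_decomposition)
qed

lemma rootI:
  "\<gamma> \<in> dual_space H \<Longrightarrow> x \<in> root_space H \<gamma> \<Longrightarrow> x \<noteq> 0 \<Longrightarrow> h \<in> H \<Longrightarrow> \<gamma> h \<noteq> 0 \<Longrightarrow> \<gamma> \<in> roots H"
  by (auto simp: roots_def)

lemma root_vector:
  assumes "\<gamma> \<in> roots H"
  obtains x where "x \<in> root_space H \<gamma>" "x \<noteq> 0"
proof -
  have "0 \<in> root_space H \<gamma>" by (simp add: root_space_def bracket_zero)
  then show thesis using assms that unfolding roots_def by blast
qed

lemma root_nonzero: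
  assumes "\<gamma> \<in> roots H"
  obtains h where "h \<in> H" "\<gamma> h \<noteq> 0"
proof -
  have "\<exists>h\<in>H. \<gamma> h \<noteq> 0"
  proof (rule ccontr)
    assume "\<not> ?thesis"
    then have "\<gamma> = (\<lambda>_. 0)"
      by (intro dual_space_eqI root_in_dual assms dual_space_closed) blast
    then show False using assms by (simp add: roots_def)
  qed
  then show thesis using that by blast
qed

lemma bracket_root_space:
  assumes "x \<in> root_space H \<gamma>" "y \<in> root_space H \<delta>"
  shows "\<lbrakk>x, y\<rbrakk> \<in> root_space H (\<lambda>h. \<gamma> h + \<delta> h)"
proof -
  have "\<lbrakk>h, \<lbrakk>x, y\<rbrakk>\<rbrakk> = (\<gamma> h + \<delta> h) *s \<lbrakk>x, y\<rbrakk>" if "h \<in> H" for h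
    using jacobi_left[of h x y]
    by (simp add: root_spaceD[OF assms(1) that] root_spaceD[OF assms(2) that]
        bracket_scale_left bracket_scale_right scale_left_distrib)
  then show ?thesis by (simp add: root_space_def)
qed

lemma B_killing: obtains c where "\<And>x y. B x y = c * killing_form x y"
  using normalized by (auto simp: normalized_killing_form_def)

lemma B_add: "B (x + y) z = B x z + B y z"
  by (rule B_killing) (simp add: killing_form_bilinear finite_dim algebra_simps)

lemma B_scale: "B (c *s x) y = c * B x y"
  by (rule B_killing) (simp add: killing_form_bilinear finite_dim)

lemma B_commute: "B x y = B y x"
  by (rule B_killing) (simp add: killing_form_commute[OF finite_dim, of x y])

lemma B_invariant: "B \<lbrakk>x, y\<rbrakk> z = B x \<lbrakk>y, z\<rbrakk>"
  by (rule B_killing) (simp add: killing_form_invariant finite_dim)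

lemma B_add_right: "B z (x + y) = B z x + B z y"
  by (metis B_add B_commute)

lemma B_scale_right: "B x (c *s y) = c * B x y"
  by (metis B_scale B_commute)

lemma B_zero: "B 0 x = 0" "B x 0 = 0"
  using B_scale[of 0 0 x] B_scale_right[of x 0 0] by simp_all

text \<open>The normalization already excludes \<open>B = 0\<close>, so that simplicity gives nondegeneracy without
  Cartan's criterion.\<close>

lemma B_nondegenerate:
  assumes "\<And>y. B x y = 0"
  shows "x = 0"
proof -
  let ?R = "{x. \<forall>y. B x y = 0}"
  have "B \<lbrakk>x, y\<rbrakk> z = 0" if "y \<in> ?R" for x y z
    using that B_invariant[of y x z] bracket_anti[of x y] B_scale[of "-1" "\<lbrakk>y, x\<rbrakk>" z] by simp
  then have "ideal ?R"
    unfolding ideal_def by (auto intro!: subspaceI simp: B_add B_scale B_zero)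
  moreover have "?R \<noteq> UNIV"
  proof
    assume "?R = UNIV"
    then have "dual_form B H (\<alpha> undefined) (\<alpha> undefined) = 0" by (auto simp: dual_form_def)
    then show False
      using normalized simple_root unfolding normalized_killing_form_def by fastforce
  qed
  ultimately have "?R = {0}" using simple by (auto simp: simple_def)
  then show ?thesis using assms by blast
qed

lemma root_spaces_orthogonal:
  assumes "x \<in> root_space H \<gamma>" "y \<in> root_space H \<delta>" "h \<in> H" "\<gamma> h + \<delta> h \<noteq> 0"
  shows "B x y = 0"
proof -
  have "\<gamma> h * B x y = B \<lbrakk>h, x\<rbrakk> y" by (simp add: root_spaceD[OF assms(1,3)] B_scale)
  also have "\<dots> = - B \<lbrakk>x, h\<rbrakk> y"
    using bracket_anti[of h x] B_scale[of "-1" "\<lbrakk>x, h\<rbrakk>" y] by simp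
  also have "\<dots> = - (\<delta> h * B x y)" by (simp add: root_spaceD[OF assms(2,3)] B_invariant B_scale_right)
  finally have "(\<gamma> h + \<delta> h) * B x y = 0" by (simp add: algebra_simps)
  then show ?thesis using assms by simp
qed

lemma B_nondegenerate_H:
  assumes "t \<in> H" "\<And>h. h \<in> H \<Longrightarrow> B t h = 0"
  shows "t = 0"
proof (rule B_nondegenerate)
  fix y
  have "y \<in> {y. B t y = 0}"
  proof (rule root_space_induct)
    show "subspace {y. B t y = 0}"
      by (rule subspaceI) (auto simp: B_zero B_add_right B_scale_right)
    fix \<gamma> x assume \<gamma>: "\<gamma> \<in> dual_space H" and x: "x \<in> root_space H \<gamma>"
    show "x \<in> {y. B t y = 0}"
    proof (cases "\<exists>h\<in>H. \<gamma> h \<noteq> 0")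
      case True
      then show ?thesis
        using root_spaces_orthogonal[of t "\<lambda>_. 0" x \<gamma>] x assms(1) by (auto simp: root_space_zero)
    next
      case False
      then have "\<gamma> = (\<lambda>_. 0)" using dual_space_eqI[OF \<gamma> dual_space_closed(3)] by blast
      then show ?thesis using x assms(2) by (simp add: root_space_zero)
    qed
  qed
  then show "B t y = 0" by simp
qed

lemma opposite_root_vector:
  assumes \<gamma>: "\<gamma> \<in> roots H" and e: "e \<in> root_space H \<gamma>" "e \<noteq> 0"
  obtains f where "f \<in> root_space H (\<lambda>h. - \<gamma> h)" "B e f = 1"
proof -
  have "\<exists>f\<in>root_space H (\<lambda>h. - \<gamma> h). B e f \<noteq> 0"
  proof (rule ccontr)
    assume *: "\<not> ?thesis"
    have "y \<in> {y. B e y = 0}" for y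
    proof (rule root_space_induct)
      show "subspace {y. B e y = 0}"
        by (rule subspaceI) (auto simp: B_zero B_add_right B_scale_right)
      fix \<delta> x assume \<delta>: "\<delta> \<in> dual_space H" and x: "x \<in> root_space H \<delta>"
      show "x \<in> {y. B e y = 0}"
      proof (cases "\<exists>h\<in>H. \<gamma> h + \<delta> h \<noteq> 0")
        case True
        then show ?thesis using root_spaces_orthogonal[OF e(1) x] by auto
      next
        case False
        then have "\<delta> = (\<lambda>h. - \<gamma> h)"
          by (intro dual_space_eqI \<delta> dual_space_closed root_in_dual \<gamma>) (metis add.commute eq_neg_iff_add_eq_0)
        then show ?thesis using x * by auto
      qed
    qed
    then have "e = 0" by (intro B_nondegenerate) simp
    then show False using e by simp
  qed
  then obtain f where f: "f \<in> root_space H (\<lambda>h. - \<gamma> h)" "B e f \<noteq> 0" by blast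
  show thesis
  proof (rule that)
    show "inverse (B e f) *s f \<in> root_space H (\<lambda>h. - \<gamma> h)"
      using f by (simp add: root_space_def bracket_scale_right mult.commute)
    show "B e (inverse (B e f) *s f) = 1" using f by (simp add: B_scale_right)
  qed
qed

lemma neg_root: "\<gamma> \<in> roots H \<Longrightarrow> (\<lambda>h. - \<gamma> h) \<in> roots H"
proof -
  assume \<gamma>: "\<gamma> \<in> roots H"
  obtain e where e: "e \<in> root_space H \<gamma>" "e \<noteq> 0" using root_vector[OF \<gamma>] .
  obtain f where f: "f \<in> root_space H (\<lambda>h. - \<gamma> h)" "B e f = 1"
    using opposite_root_vector[OF \<gamma> e] .
  obtain h where "h \<in> H" "\<gamma> h \<noteq> 0" using root_nonzero[OF \<gamma>] .
  moreover have "f \<noteq> 0" using f(2) by (auto simp: B_zero)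
  ultimately show ?thesis
    using rootI[OF dual_space_closed(2)[OF root_in_dual[OF \<gamma>]] f(1)] by simp
qed

lemma dual_vector_eqI:
  assumes "t \<in> H" "\<And>h. h \<in> H \<Longrightarrow> B t h = \<gamma> h"
  shows "dual_vector B H \<gamma> = t"
  unfolding dual_vector_def
proof (rule the_equality)
  fix s assume s: "s \<in> H \<and> (\<forall>h\<in>H. B s h = \<gamma> h)"
  have "B (s + (-1) *s t) h = 0" if "h \<in> H" for h
    unfolding B_add B_scale using s assms that by simp
  moreover have "s + (-1) *s t \<in> H"
    using s assms(1) by (intro subspace_add subspace_scale subspace_H) auto
  ultimately have "s + (-1) *s t = 0" by (intro B_nondegenerate_H)
  then show "s = t" by simp
qed (use assms in blast)

lemma bracket_opposite_H:
  assumes "e \<in> root_space H \<gamma>" "f \<in> root_space H (\<lambda>h. - \<gamma> h)"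
  shows "\<lbrakk>e, f\<rbrakk> \<in> H" "h \<in> H \<Longrightarrow> B \<lbrakk>e, f\<rbrakk> h = B e f * \<gamma> h"
proof -
  show "\<lbrakk>e, f\<rbrakk> \<in> H" using bracket_root_space[OF assms] by (simp add: root_space_zero)
  assume h: "h \<in> H"
  have "\<lbrakk>f, h\<rbrakk> = \<gamma> h *s f"
    using root_spaceD[OF assms(2) h] bracket_anti[of f h] by simp
  then show "B \<lbrakk>e, f\<rbrakk> h = B e f * \<gamma> h" by (simp add: B_invariant B_scale_right)
qed

text \<open>The bracket of suitably scaled opposite root vectors represents the root, which gives existence
  without appeal to the dimension of the dual space.\<close>

lemma dual_vector_root:
  assumes \<gamma>: "\<gamma> \<in> roots H"
  shows "dual_vector B H \<gamma> \<in> H" "h \<in> H \<Longrightarrow> B (dual_vector B H \<gamma>) h = \<gamma> h"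
proof -
  obtain e where e: "e \<in> root_space H \<gamma>" "e \<noteq> 0" using root_vector[OF \<gamma>] .
  obtain f where f: "f \<in> root_space H (\<lambda>h. - \<gamma> h)" "B e f = 1"
    using opposite_root_vector[OF \<gamma> e] .
  have "dual_vector B H \<gamma> = \<lbrakk>e, f\<rbrakk>"
    by (rule dual_vector_eqI) (simp_all add: bracket_opposite_H[OF e(1) f(1)] f(2))
  then show "dual_vector B H \<gamma> \<in> H" "h \<in> H \<Longrightarrow> B (dual_vector B H \<gamma>) h = \<gamma> h"
    by (simp_all add: bracket_opposite_H[OF e(1) f(1)] f(2))
qed

lemma bracket_opposite:
  assumes \<gamma>: "\<gamma> \<in> roots H" and e: "e \<in> root_space H \<gamma>" and f: "f \<in> root_space H (\<lambda>h. - \<gamma> h)"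
  shows "\<lbrakk>e, f\<rbrakk> = B e f *s dual_vector B H \<gamma>"
proof -
  let ?d = "\<lbrakk>e, f\<rbrakk> + (- B e f) *s dual_vector B H \<gamma>"
  have "?d = 0"
  proof (rule B_nondegenerate_H)
    show "?d \<in> H" by (intro subspace_add subspace_scale subspace_H bracket_opposite_H[OF e f] dual_vector_root \<gamma>)
    show "B ?d h = 0" if "h \<in> H" for h
      unfolding B_add B_scale bracket_opposite_H(2)[OF e f that] dual_vector_root(2)[OF \<gamma> that] by simp
  qed
  then show ?thesis by simp
qed

abbreviation pairing :: "('g \<Rightarrow> complex) \<Rightarrow> ('g \<Rightarrow> complex) \<Rightarrow> complex"
  where "pairing \<gamma> \<delta> \<equiv> \<gamma> (dual_vector B H \<delta>)"

lemma dual_form_pairing: "\<gamma> \<in> roots H \<Longrightarrow> \<delta> \<in> roots H \<Longrightarrow> dual_form B H \<gamma> \<delta> = pairing \<gamma> \<delta>"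
  by (simp add: dual_form_def dual_vector_root)

lemma pairing_self: "\<gamma> \<in> roots H \<Longrightarrow> pairing \<gamma> \<gamma> = 2"
  using normalized by (auto simp: normalized_killing_form_def simp flip: dual_form_pairing)

lemma pairing_commute: "\<gamma> \<in> roots H \<Longrightarrow> \<delta> \<in> roots H \<Longrightarrow> pairing \<gamma> \<delta> = pairing \<delta> \<gamma>"
  by (metis B_commute dual_vector_root)

text \<open>Compare the square lengths: \<open>2 = 2 + 2 (\<gamma>, \<delta>) + 2\<close>.\<close>

lemma pairing_if_sum_root:
  assumes r: "\<gamma> \<in> roots H" "\<delta> \<in> roots H" and sum: "(\<lambda>h. \<gamma> h + \<delta> h) \<in> roots H"
  shows "pairing \<gamma> \<delta> = - 1"
proof -
  let ?t = "dual_vector B H"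
  have "?t (\<lambda>h. \<gamma> h + \<delta> h) = ?t \<gamma> + ?t \<delta>"
    by (rule dual_vector_eqI) (simp_all add: subspace_add subspace_H dual_vector_root r B_add)
  then have "\<gamma> (?t \<gamma> + ?t \<delta>) + \<delta> (?t \<gamma> + ?t \<delta>) = 2"
    using pairing_self[OF sum] by simp
  then have "2 + pairing \<gamma> \<delta> + (pairing \<delta> \<gamma> + 2) = 2"
    by (simp add: dual_space_add root_in_dual r dual_vector_root pairing_self)
  then have "2 * (pairing \<gamma> \<delta> + 1) = 0"
    unfolding distrib_left using pairing_commute[OF r] by (simp add: add.commute)
  then show ?thesis by (simp only: mult_eq_0_iff) (simp add: eq_neg_iff_add_eq_0)
qed

lemma pairing_neg: "\<gamma> \<in> roots H \<Longrightarrow> \<delta> \<in> roots H \<Longrightarrow> pairing \<gamma> (\<lambda>h. - \<delta> h) = - pairing \<gamma> \<delta>"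
  using pairing_commute[of \<gamma> "\<lambda>h. - \<delta> h"] pairing_commute[of \<gamma> \<delta>] neg_root by simp

lemma bracket_sum_root:
  assumes "\<gamma> \<in> dual_space H" "\<delta> \<in> dual_space H" "x \<in> root_space H \<gamma>" "y \<in> root_space H \<delta>" "\<lbrakk>x, y\<rbrakk> \<noteq> 0"
    and "\<delta> \<noteq> (\<lambda>h. - \<gamma> h)"
  shows "(\<lambda>h. \<gamma> h + \<delta> h) \<in> roots H"
proof -
  obtain h where "h \<in> H" "\<gamma> h + \<delta> h \<noteq> 0"
    using assms(1,2,6) dual_space_eqI[OF assms(2) dual_space_closed(2)[OF assms(1)]]
    by (metis eq_neg_iff_add_eq_0 add.commute)
  then show ?thesis
    using rootI[OF dual_space_closed(1)[OF assms(1,2)] bracket_root_space[OF assms(3,4)]] assms(5) by blast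
qed

text \<open>Root vectors of a simply-laced algebra are extremal: unless \<open>\<beta> = -\<gamma>\<close>, a nonzero value on the
  root space of \<open>\<beta>\<close> would make \<open>\<beta>\<close>, \<open>\<beta> + \<gamma>\<close> and \<open>\<beta> + 2\<gamma>\<close> roots, and the first two having
  square length \<open>2\<close> forces \<open>(\<beta>, \<gamma>) = -1\<close>, so that \<open>\<beta> + 2\<gamma>\<close> would have square length \<open>6\<close>.\<close>

lemma root_vector_extremal:
  assumes \<gamma>: "\<gamma> \<in> roots H" and e: "e \<in> root_space H \<gamma>"
  shows "\<lbrakk>e, \<lbrakk>e, a\<rbrakk>\<rbrakk> = (- 2 * B e a) *s e"
proof -
  have "a \<in> {a. \<lbrakk>e, \<lbrakk>e, a\<rbrakk>\<rbrakk> = (- 2 * B e a) *s e}"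
  proof (rule root_space_induct)
    show "subspace {a. \<lbrakk>e, \<lbrakk>e, a\<rbrakk>\<rbrakk> = (- 2 * B e a) *s e}"
      by (rule subspaceI)
        (auto simp: bracket_zero B_zero bracket_add_right B_add_right bracket_scale_right
          B_scale_right algebra_simps scale_left_distrib)
    fix \<beta> a assume \<beta>: "\<beta> \<in> dual_space H" and a: "a \<in> root_space H \<beta>"
    obtain h where h: "h \<in> H" "\<gamma> h \<noteq> 0" using root_nonzero[OF \<gamma>] .
    have "\<lbrakk>e, \<lbrakk>e, a\<rbrakk>\<rbrakk> = (- 2 * B e a) *s e"
    proof (cases "\<beta> = (\<lambda>h. - \<gamma> h)")
      case True
      let ?t = "dual_vector B H \<gamma>"
      have "\<lbrakk>e, ?t\<rbrakk> = (- 2) *s e"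
        using root_spaceD[OF e dual_vector_root(1)[OF \<gamma>]] bracket_anti[of e ?t]
        by (simp add: pairing_self \<gamma>)
      then show ?thesis
        using bracket_opposite[OF \<gamma> e] a True by (simp add: bracket_scale_right)
    next
      case False
      have "\<exists>h\<in>H. \<gamma> h + \<beta> h \<noteq> 0"
        using False dual_space_eqI[OF \<beta> dual_space_closed(2)[OF root_in_dual[OF \<gamma>]]]
        by (metis eq_neg_iff_add_eq_0 add.commute)
      then have B: "B e a = 0" using root_spaces_orthogonal[OF e a] by auto
      moreover have "\<lbrakk>e, \<lbrakk>e, a\<rbrakk>\<rbrakk> = 0"
      proof (rule ccontr)
        assume nz: "\<lbrakk>e, \<lbrakk>e, a\<rbrakk>\<rbrakk> \<noteq> 0"
        then have nz': "\<lbrakk>e, a\<rbrakk> \<noteq> 0" "a \<noteq> 0" by (auto simp: bracket_zero)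
        have "\<beta> \<noteq> (\<lambda>_. 0)"
        proof
          assume "\<beta> = (\<lambda>_. 0)"
          then have "a \<in> H" using a by (simp add: root_space_zero)
          then have "\<lbrakk>e, a\<rbrakk> = (- \<gamma> a) *s e"
            using root_spaceD[OF e] bracket_anti[of e a] by simp
          then show False using nz by (simp add: bracket_scale_right bracket_self bracket_minus)
        qed
        then have \<beta>r: "\<beta> \<in> roots H" using \<beta> a nz' by (auto simp: roots_def)
        have r1: "(\<lambda>h. \<gamma> h + \<beta> h) \<in> roots H"
          by (rule bracket_sum_root[OF root_in_dual[OF \<gamma>] \<beta> e a nz'(1) False])
        have p: "pairing \<beta> \<gamma> = - 1"
          using pairing_if_sum_root[OF \<gamma> \<beta>r r1] pairing_commute[OF \<gamma> \<beta>r] by simp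
        have "(\<lambda>h. \<gamma> h + \<beta> h) \<noteq> (\<lambda>h. - \<gamma> h)"
        proof
          assume "(\<lambda>h. \<gamma> h + \<beta> h) = (\<lambda>h. - \<gamma> h)"
          then have "pairing \<gamma> \<gamma> + pairing \<beta> \<gamma> = - pairing \<gamma> \<gamma>" by (rule fun_cong)
          then show False using p pairing_self[OF \<gamma>] by simp
        qed
        then have r2: "(\<lambda>h. \<gamma> h + (\<gamma> h + \<beta> h)) \<in> roots H"
          by (rule bracket_sum_root[OF root_in_dual[OF \<gamma>] root_in_dual[OF r1] e
                bracket_root_space[OF e a] nz])
        have "pairing (\<lambda>h. \<gamma> h + \<beta> h) \<gamma> = - 1"
          using pairing_if_sum_root[OF \<gamma> r1 r2] pairing_commute[OF \<gamma> r1] by simp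
        then show False using p pairing_self[OF \<gamma>] by simp
      qed
      ultimately show ?thesis by simp
    qed
    then show "a \<in> {a. \<lbrakk>e, \<lbrakk>e, a\<rbrakk>\<rbrakk> = (- 2 * B e a) *s e}" by simp
  qed
  then show ?thesis by simp
qed

lemma root_vector_isotropic:
  assumes \<gamma>: "\<gamma> \<in> roots H" and e: "e \<in> root_space H \<gamma>"
  shows "B e e = 0"
proof -
  obtain h where "h \<in> H" "\<gamma> h \<noteq> 0" using root_nonzero[OF \<gamma>] .
  then show ?thesis using root_spaces_orthogonal[OF e e] by simp
qed

text \<open>For \<open>\<gamma> \<noteq> \<plusminus>\<delta>\<close>, evaluate \<open>[[e, f], a] = (\<gamma>, \<delta>) a\<close> with \<open>a\<close> of weight \<open>\<gamma>\<close> and \<open>e\<close>, \<open>f\<close> of weights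
  \<open>\<delta>\<close>, \<open>-\<delta>\<close>: either the pairing is \<open>0\<close>, or \<open>\<gamma> + \<delta>\<close> is a root and it is \<open>-1\<close>, or \<open>\<gamma> - \<delta>\<close> is a root
  and it is \<open>1\<close>.\<close>

lemma pairing_integral:
  assumes \<gamma>: "\<gamma> \<in> roots H" and \<delta>: "\<delta> \<in> roots H"
  shows "pairing \<gamma> \<delta> \<in> \<int>"
proof (cases "\<gamma> = \<delta> \<or> \<gamma> = (\<lambda>h. - \<delta> h)")
  case True
  then show ?thesis using pairing_self[OF \<delta>] by auto
next
  case False
  obtain e where e: "e \<in> root_space H \<delta>" "e \<noteq> 0" using root_vector[OF \<delta>] .
  obtain f where f: "f \<in> root_space H (\<lambda>h. - \<delta> h)" "B e f = 1"
    using opposite_root_vector[OF \<delta> e] .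
  obtain a where a: "a \<in> root_space H \<gamma>" "a \<noteq> 0" using root_vector[OF \<gamma>] .
  have "\<lbrakk>\<lbrakk>e, f\<rbrakk>, a\<rbrakk> = pairing \<gamma> \<delta> *s a"
    using bracket_opposite[OF \<delta> e(1) f(1)] f(2) root_spaceD[OF a(1) dual_vector_root(1)[OF \<delta>]] by simp
  then have *: "pairing \<gamma> \<delta> *s a = \<lbrakk>e, \<lbrakk>f, a\<rbrakk>\<rbrakk> - \<lbrakk>f, \<lbrakk>e, a\<rbrakk>\<rbrakk>" by (simp add: jacobi_left)
  consider "\<lbrakk>e, a\<rbrakk> \<noteq> 0" | "\<lbrakk>f, a\<rbrakk> \<noteq> 0" | "pairing \<gamma> \<delta> = 0"
    using * a(2) by (metis bracket_zero(2) diff_zero scale_eq_0_iff)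
  then show ?thesis
  proof cases
    case 1
    have "(\<lambda>h. \<delta> h + \<gamma> h) \<in> roots H"
      using bracket_sum_root[OF root_in_dual[OF \<delta>] root_in_dual[OF \<gamma>] e(1) a(1) 1] False by simp
    from pairing_if_sum_root[OF \<delta> \<gamma> this] show ?thesis using pairing_commute[OF \<gamma> \<delta>] by simp
  next
    case 2
    have "(\<lambda>h. - \<delta> h + \<gamma> h) \<in> roots H"
      using bracket_sum_root[OF root_in_dual[OF neg_root[OF \<delta>]] root_in_dual[OF \<gamma>] f(1) a(1) 2] False by simp
    from pairing_if_sum_root[OF neg_root[OF \<delta>] \<gamma> this] show ?thesis
      using pairing_commute[OF \<gamma> \<delta>] by simp
  next
    case 3
    then show ?thesis by simp
  qed
qed

end

section \<open>Modes acting on the basic module\<close>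

text \<open>Leibniz's rule for \<open>act x\<close>, in the form that moves local nilpotency from a generator to the
  whole module.\<close>

lemma (in lie_module) nilpotent_act:
  assumes "((\<lambda>z. bracket x z) ^^ j) y = 0" "(act x ^^ k) v = 0"
  shows "(act x ^^ (j + k)) (act y v) = 0"
proof -
  have zero: "act 0 v = 0" "act y 0 = 0" for y v
    using act_add_left[of 0 0 v] act_add_right[of y 0 0] by simp_all
  have power_zero: "(act x ^^ n) 0 = 0" for n
    by (induction n) (simp_all add: zero)
  have power_add: "(act x ^^ n) (v + w) = (act x ^^ n) v + (act x ^^ n) w" for n v w
    by (induction n) (simp_all add: act_add_right)
  show ?thesis
    using assms
  proof (induction "j + k" arbitrary: j k y v rule: less_induct)
    case less
    consider "j = 0" | "k = 0" | j' k' where "j = Suc j'" "k = Suc k'"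
      by (metis not0_implies_Suc)
    then show ?case
    proof cases
      case 3
      have "act x (act y v) = act (bracket x y) v + act y (act x v)"
        by (simp add: act_bracket)
      moreover have "(act x ^^ (j' + k)) (act (bracket x y) v) = 0"
        using less.prems 3 by (intro less.hyps) (simp_all add: funpow_swap1)
      moreover have "(act x ^^ (j + k')) (act y (act x v)) = 0"
        using less.prems 3 by (intro less.hyps) (simp_all add: funpow_swap1)
      moreover have "(act x ^^ (j + k)) (act y v) = (act x ^^ (j' + k)) (act x (act y v))"
        using 3 by (simp add: funpow_swap1)
      moreover have "j + k' = j' + k" using 3 by simp
      ultimately show ?thesis by (simp only: power_add) simp
    qed (use less.prems in \<open>simp_all add: zero power_zero\<close>)
  qed
qed

locale affine_setup =
  root_datum scale bracket H \<alpha> \<omega> B + M: basic_module scale bracket B vscale act vac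
  for scale :: "complex \<Rightarrow> 'g::ab_group_add \<Rightarrow> 'g" (infixr \<open>*s\<close> 75)
    and bracket :: "'g \<Rightarrow> 'g \<Rightarrow> 'g" (\<open>\<lbrakk>_, _\<rbrakk>\<close>)
    and H :: "'g set"
    and \<alpha> :: "'l::finite \<Rightarrow> 'g \<Rightarrow> complex"
    and \<omega> :: "'l \<Rightarrow> 'g"
    and B :: "'g \<Rightarrow> 'g \<Rightarrow> complex"
    and vscale :: "complex \<Rightarrow> 'v::ab_group_add \<Rightarrow> 'v" (infixr \<open>*v\<close> 75)
    and act :: "'g affine \<Rightarrow> 'v \<Rightarrow> 'v"
    and vac :: 'v +
  fixes L0 :: "'v \<Rightarrow> 'v"
  assumes degree: "M.degree_operator L0"
begin

abbreviation mode :: "'g \<Rightarrow> int \<Rightarrow> 'v \<Rightarrow> 'v"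
  where "mode a m \<equiv> act (loop_element a m)"

abbreviation central :: "complex \<Rightarrow> 'g affine"
  where "central z \<equiv> (0, z)"

lemma act_central: "act (central z) v = z *v v"
proof -
  have "central z = affine_scale scale z central_element"
    by (simp add: affine_scale_def central_element_def Poly_Mapping.map_eq_zero_iff)
  then show ?thesis by (simp only: M.act_scale_left M.level_one)
qed

lemma mode_add: "mode (a + b) m v = mode a m v + mode b m v"
  by (simp add: loop_element_def single_add flip: M.act_add_left)

lemma mode_scale: "mode (c *s a) m v = c *v mode a m v"
  by (simp add: loop_element_def affine_scale_def flip: M.act_scale_left)

lemma mode_zero: "mode 0 m v = 0" "mode a m 0 = 0"
  using mode_add[of 0 0 m v] M.act_add_right[of "loop_element a m" 0 0] by simp_all

lemma mode_minus: "mode (- a) m v = - mode a m v"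
  using mode_scale[of "- 1" a m v] by simp

lemma bracket_loop:
  "affine_bracket bracket B (loop_element a m) (loop_element b n) =
    loop_element \<lbrakk>a, b\<rbrakk> (m + n) + central (if m + n = 0 then of_int m * B a b else 0)"
  by (subst affine_bracket_loop_element) (simp_all add: bracket_zero B_zero loop_element_def)

lemma mode_commute:
  "mode a m (mode b n v) = mode b n (mode a m v) + mode \<lbrakk>a, b\<rbrakk> (m + n) v
    + (if m + n = 0 then of_int m * B a b else 0) *v v"
  using M.act_bracket[of "loop_element a m" "loop_element b n" v]
  by (simp add: bracket_loop M.act_add_left act_central algebra_simps)

lemma linear_L0: "Vector_Spaces.linear (*v) (*v) L0"
  and L0_mode: "L0 (mode a m v) = mode a m (L0 v) + (- of_int m) *v mode a m v"
  and L0_vac: "L0 vac = 0"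
  using degree by (auto simp: M.degree_operator_def algebra_simps)

lemma linear_mode: "Vector_Spaces.linear (*v) (*v) (mode a m)"
  by (simp add: Vector_Spaces.linear_iff M.V.vector_space_axioms M.act_add_right M.act_scale_right)

text \<open>For \<open>u\<close> killed by all modes \<open>a(m)\<close> with \<open>m \<ge> 1\<close> this is the submodule generated by \<open>u\<close>, as in the
  theorem of Poincare, Birkhoff and Witt; no monomial basis is required, only that the degrees on it
  are bounded below by that of \<open>u\<close>.\<close>

inductive_set lowered :: "'v \<Rightarrow> 'v set" for u where
  base: "u \<in> lowered u"
| add: "v \<in> lowered u \<Longrightarrow> w \<in> lowered u \<Longrightarrow> v + w \<in> lowered u"
| scale: "v \<in> lowered u \<Longrightarrow> c *v v \<in> lowered u"
| mode: "v \<in> lowered u \<Longrightarrow> m \<le> 0 \<Longrightarrow> mode a m v \<in> lowered u"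

lemma submodule_lowered:
  assumes u: "\<And>a m. m \<ge> 1 \<Longrightarrow> mode a m u = 0"
  shows "M.submodule (lowered u)"
proof -
  have zero: "0 \<in> lowered u" using lowered.scale[OF lowered.base[of u], where c = 0] by simp
  have modes: "mode a m v \<in> lowered u" if "v \<in> lowered u" for a m v
    using that
  proof (induction arbitrary: a m)
    case base
    then show ?case
      by (cases "m \<ge> 1") (use u zero lowered.mode[OF lowered.base] in auto)
  next
    case (mode v n b)
    show ?case
      unfolding mode_commute[of a m]
      by (intro lowered.add lowered.scale lowered.mode mode)
  qed (auto simp: M.act_add_right M.act_scale_right intro: lowered.intros)
  have "act x v \<in> lowered u" if "v \<in> lowered u" for x v
    by (induction x rule: affine_induct)
      (use that in \<open>auto simp: modes act_central M.act_add_left intro: lowered.intros\<close>)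
  moreover have "M.V.subspace (lowered u)"
    by (rule M.V.subspaceI) (auto intro: zero lowered.intros)
  ultimately show ?thesis by (auto simp: M.submodule_def)
qed

lemma lowered_degree:
  assumes u: "L0 u = of_nat d *v u" and "w \<in> lowered u"
  shows "w \<in> M.V.span {v. \<exists>c\<in>of_nat ` {d..}. L0 v = c *v v}"
  using assms(2)
proof induction
  case base
  show ?case using u by (auto intro!: M.V.span_base)
next
  case (mode v m a)
  let ?E = "{v. \<exists>c\<in>of_nat ` {d..}. L0 v = c *v v}"
  interpret T: Vector_Spaces.linear "(*v)" "(*v)" "mode a m" by (rule linear_mode)
  have "mode a m ` ?E \<subseteq> ?E"
  proof clarsimp
    fix v k assume k: "d \<le> k" "L0 v = of_nat k *v v"
    have "L0 (mode a m v) = of_nat (k + nat (- m)) *v mode a m v"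
      using k(2) mode(2) by (simp add: L0_mode M.act_scale_right M.V.scale_left_diff_distrib)
    then show "\<exists>l\<in>{d..}. L0 (mode a m v) = of_nat l *v mode a m v"
      using k by (intro bexI[of _ "k + nat (- m)"]) auto
  qed
  then have "M.V.span (mode a m ` ?E) \<subseteq> M.V.span ?E" by (rule M.V.span_mono)
  then show ?case using mode(3) by (auto simp: T.span_image)
qed (auto intro: M.V.span_add M.V.span_scale)

lemma degree_nonneg:
  "v \<in> M.V.span {v. \<exists>c\<in>range of_nat. L0 v = c *v v}"
proof -
  have "M.submodule (lowered vac)"
    by (rule submodule_lowered) (simp add: M.vac_annihilated)
  then have "lowered vac = UNIV"
    using M.vac_generates lowered.base unfolding M.generates_def by blast
  then show ?thesis using lowered_degree[of vac 0 v] by (simp add: L0_vac atLeast_0)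
qed

lemma vac_nonzero: "vac \<noteq> 0"
proof
  assume "vac = 0"
  moreover have "M.submodule {0}"
    using M.act_add_right[of _ 0 0] by (auto simp: M.submodule_def intro: M.V.subspace_single_0)
  ultimately have "{0} = (UNIV :: 'v set)" using M.vac_generates by (simp add: M.generates_def)
  then show False using M.irreducible unfolding M.irreducible_def by (metis UNIV_I singletonD)
qed

text \<open>The computation below makes \<open>e(-1)\<^sup>2 vac\<close> singular; since it has degree \<open>2\<close>, the submodule
  that it generates misses the vacuum, and irreducibility kills it.\<close>

lemma mode_square_vac:
  assumes ext: "\<And>a. \<lbrakk>e, \<lbrakk>e, a\<rbrakk>\<rbrakk> = (- 2 * B e a) *s e" and iso: "B e e = 0"
  shows "mode e (- 1) (mode e (- 1) vac) = 0"
proof (rule ccontr)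
  define u where "u = mode e (- 1) (mode e (- 1) vac)"
  assume "mode e (- 1) (mode e (- 1) vac) \<noteq> 0"
  then have "u \<noteq> 0" by (simp add: u_def)
  have ann: "mode a m vac = 0" if "m \<ge> 0" for a m
    using that by (rule M.vac_annihilated)
  have "mode a m u = 0" if m: "m \<ge> 1" for a m
  proof -
    have 1: "mode a m (mode e (- 1) vac) = (if m = 1 then B a e else 0) *v vac"
      using m by (simp add: mode_commute[of a m] ann mode_zero)
    have 2: "mode \<lbrakk>a, e\<rbrakk> (m - 1) (mode e (- 1) vac) = mode \<lbrakk>\<lbrakk>a, e\<rbrakk>, e\<rbrakk> (m - 2) vac"
    proof -
      have "B \<lbrakk>a, e\<rbrakk> e = 0" by (simp add: B_invariant bracket_self B_zero)
      then show ?thesis using m by (simp add: mode_commute[of "\<lbrakk>a, e\<rbrakk>" "m - 1"] ann mode_zero)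
    qed
    have 3: "\<lbrakk>\<lbrakk>a, e\<rbrakk>, e\<rbrakk> = (- 2 * B a e) *s e"
      using ext[of a] bracket_anti[of a e] bracket_anti[of "\<lbrakk>a, e\<rbrakk>" e] by (simp add: bracket_minus B_commute)
    have "mode a m u = mode e (- 1) (mode a m (mode e (- 1) vac))
        + mode \<lbrakk>\<lbrakk>a, e\<rbrakk>, e\<rbrakk> (m - 2) vac + (if m = 1 then B a e else 0) *v mode e (- 1) vac"
      unfolding u_def mode_commute[of a m e "- 1" "mode e (- 1) vac"] using 2 by simp
    also have "\<dots> = 0"
    proof (cases "m = 1")
      case True
      have "b *v w + (- (2 * b)) *v w + b *v w = 0" for b w
        unfolding M.V.scale_left_distrib[symmetric] by simp
      from this[of "B a e" "mode e (- 1) vac"] show ?thesis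
        unfolding 1 3 mode_scale using True by (simp add: mode_scale mode_minus M.act_scale_right)
    next
      case False
      then show ?thesis using m by (simp add: 1 ann M.act_scale_right mode_zero)
    qed
    finally show ?thesis .
  qed
  then have "M.submodule (lowered u)" by (rule submodule_lowered)
  then have "lowered u = {0} \<or> lowered u = UNIV" using M.irreducible by (simp add: M.irreducible_def)
  with \<open>u \<noteq> 0\<close> lowered.base[of u] have "vac \<in> lowered u" by auto
  moreover have "L0 u = of_nat 2 *v u"
  proof -
    have "L0 u = u + u" by (simp add: u_def L0_mode L0_vac mode_zero M.act_add_right)
    then show ?thesis using M.V.scale_left_distrib[of 1 1 u] by simp
  qed
  ultimately have "vac \<in> M.V.span {v. \<exists>c\<in>of_nat ` {2..}. L0 v = c *v v}"
    using lowered_degree by blast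
  moreover have "(0 :: complex) \<notin> of_nat ` {2..}" by auto
  moreover have "L0 vac = 0 *v vac" by (simp add: L0_vac)
  ultimately have "vac = 0"
    using M.V.eigenvector_outside_spectrum[OF linear_L0] by blast
  then show False using vac_nonzero by simp
qed

text \<open>By extremality, three brackets with \<open>e(m)\<close> kill every \<open>a(n)\<close>, so that by \<open>nilpotent_act\<close> the
  locally nilpotent vectors form a submodule.  It contains the vacuum: \<open>e(m)\<close> kills it for \<open>m \<ge> 0\<close>,
  and its square does for \<open>m = -1\<close>.\<close>

lemma locally_nilpotent:
  assumes ext: "\<And>a. \<lbrakk>e, \<lbrakk>e, a\<rbrakk>\<rbrakk> = (- 2 * B e a) *s e" and iso: "B e e = 0" and m: "m \<ge> - 1"
  shows "\<exists>k. (mode e m ^^ k) v = 0"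
proof -
  let ?N = "{v. \<exists>k. (mode e m ^^ k) v = 0}" and ?ad = "\<lambda>z. affine_bracket bracket B (loop_element e m) z"
  have zero: "(mode e m ^^ j) 0 = 0" for j by (induction j) (simp_all add: mode_zero)
  have more: "(mode e m ^^ (j + k)) v = 0" if "(mode e m ^^ k) v = 0" for j k v
    using that by (simp add: funpow_add zero)
  have N: "M.V.subspace ?N"
  proof (rule M.V.subspaceI)
    show "0 \<in> ?N" using zero by auto
    fix v w assume "v \<in> ?N" "w \<in> ?N"
    then obtain j k where jk: "(mode e m ^^ j) v = 0" "(mode e m ^^ k) w = 0" by auto
    have "(mode e m ^^ n) (v + w) = (mode e m ^^ n) v + (mode e m ^^ n) w" for n
      by (induction n) (simp_all add: M.act_add_right)
    then have "(mode e m ^^ (j + k)) (v + w) = 0"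
      using more[OF jk(1), of k] more[OF jk(2), of j] by (simp add: add.commute)
    then show "v + w \<in> ?N" by blast
  next
    fix c v assume "v \<in> ?N"
    moreover have "(mode e m ^^ n) (c *v v) = c *v (mode e m ^^ n) v" for n
      by (induction n) (simp_all add: M.act_scale_right)
    ultimately show "c *v v \<in> ?N" by auto
  qed
  have "act x v \<in> ?N" if v: "v \<in> ?N" for x v
  proof (induction x rule: affine_induct)
    case (loop a n)
    have central: "?ad (x + central z) = ?ad x" for x z
      by (simp add: M.bracket_add_right) (simp add: affine_bracket_def)
    have B_minus: "B e (- (c *s e)) = 0" for c
      using B_scale_right[of e "- c" e] by (simp add: iso)
    have "B e \<lbrakk>e, a\<rbrakk> = 0" by (simp add: bracket_self B_zero flip: B_invariant)
    then have "?ad (?ad (?ad (loop_element a n))) = 0"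
      by (simp add: bracket_loop central ext bracket_scale_right bracket_minus bracket_self B_minus iso)
        (simp add: loop_element_def zero_prod_def)
    then have "(?ad ^^ 3) (loop_element a n) = 0" by (simp add: numeral_3_eq_3)
    moreover obtain k where "(mode e m ^^ k) v = 0" using v by auto
    ultimately have "(mode e m ^^ (3 + k)) (mode a n v) = 0" by (rule M.nilpotent_act)
    then show ?case by blast
  next
    case (central z)
    then show ?case using v M.V.subspace_scale[OF N] by (simp add: act_central)
  next
    case (add x y)
    then show ?case using M.V.subspace_add[OF N] by (simp add: M.act_add_left)
  qed
  moreover have "vac \<in> ?N"
  proof (cases "m \<ge> 0")
    case True
    then have "(mode e m ^^ 1) vac = 0" by (simp add: M.vac_annihilated)
    then show ?thesis by blast
  next
    case False
    then have "m = - 1" using m by simp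
    then have "(mode e m ^^ 2) vac = 0"
      using mode_square_vac[OF ext iso] by (simp add: numeral_2_eq_2)
    then show ?thesis by blast
  qed
  ultimately have "?N = UNIV" using M.vac_generates N unfolding M.generates_def M.submodule_def by blast
  then show ?thesis by blast
qed

section \<open>Translations of the weight spaces\<close>

text \<open>The degree is an integer here because a reflection may lower it; the spaces of negative degree
  vanish by \<open>wt_negative\<close>.\<close>

definition wt :: "('l \<Rightarrow> int) \<Rightarrow> int \<Rightarrow> 'v set"
  where "wt n r = {v. (\<forall>j. mode (\<omega> j) 0 v = of_int (n j) *v v) \<and> L0 v = of_int r *v v}"

lemma wt_weight_space: "wt n (int r) = M.weight_space \<omega> L0 n r"
  by (simp add: wt_def M.weight_space_def)

lemma subspace_wt: "M.V.subspace (wt n r)"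
proof -
  interpret L: Vector_Spaces.linear "(*v)" "(*v)" L0 by (rule linear_L0)
  show ?thesis
    by (rule M.V.subspaceI)
      (auto simp: wt_def mode_zero L.zero L.add L.scale M.act_add_right M.act_scale_right
        M.V.scale_right_distrib mult.commute)
qed

lemma wt_negative:
  assumes "r < 0" "v \<in> wt n r"
  shows "v = 0"
proof -
  have "(of_int r :: complex) \<noteq> of_nat k" for k
    using assms(1) by (metis of_int_eq_iff of_int_of_nat_eq of_nat_0_le_iff not_le)
  then have "(of_int r :: complex) \<notin> range of_nat" by auto
  moreover have "L0 v = of_int r *v v" using assms(2) by (simp add: wt_def)
  ultimately show ?thesis
    using M.V.eigenvector_outside_spectrum[OF linear_L0 _ degree_nonneg] by blast
qed

abbreviation shift :: "('l \<Rightarrow> int) \<Rightarrow> 'l \<Rightarrow> int \<Rightarrow> 'l \<Rightarrow> int"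
  where "shift n i k \<equiv> (\<lambda>j. n j + (if j = i then k else 0))"

lemma mode_wt:
  assumes e: "e \<in> root_space H \<gamma>" and \<gamma>: "\<And>j. \<gamma> (\<omega> j) = of_int (if j = i then k else 0)" and v: "v \<in> wt n r"
  shows "mode e m v \<in> wt (shift n i k) (r - m)"
proof -
  have "mode (\<omega> j) 0 (mode e m v) = of_int (shift n i k j) *v mode e m v" for j
  proof -
    have "mode (\<omega> j) 0 (mode e m v) = mode e m (mode (\<omega> j) 0 v) + mode \<lbrakk>\<omega> j, e\<rbrakk> m v"
      by (simp add: mode_commute[of "\<omega> j" 0])
    also have "\<dots> = of_int (n j) *v mode e m v + of_int (if j = i then k else 0) *v mode e m v"
      using v root_spaceD[OF e coweight(1), of j] \<gamma>[of j]
      by (simp only: mode_scale) (simp add: wt_def M.act_scale_right)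
    finally show ?thesis by (simp only: of_int_add M.V.scale_left_distrib)
  qed
  moreover have "L0 (mode e m v) = of_int (r - m) *v mode e m v"
    using v by (simp add: wt_def L0_mode M.act_scale_right M.V.scale_left_diff_distrib)
  ultimately show ?thesis by (simp add: wt_def)
qed

lemma mode_power_wt:
  assumes e: "e \<in> root_space H \<gamma>" and \<gamma>: "\<And>j. \<gamma> (\<omega> j) = of_int (if j = i then k else 0)" and v: "v \<in> wt n r"
  shows "(mode e m ^^ l) v \<in> wt (shift n i (int l * k)) (r - int l * m)"
proof (induction l)
  case 0
  then show ?case using v by (simp cong: if_cong)
next
  case (Suc l)
  have "shift (shift n i (int l * k)) i k = shift n i (int (Suc l) * k)"
    by (auto simp: algebra_simps)
  moreover have "r - int l * m - m = r - int (Suc l) * m" by (simp add: algebra_simps)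
  ultimately show ?case
    using mode_wt[OF e \<gamma> Suc, of m] by (simp only: funpow.simps o_apply)
qed

text \<open>The Cartan matrix with integer entries; the pairing is integral by \<open>pairing_integral\<close>, so that
  taking the floor loses nothing.\<close>

definition C :: "'l \<Rightarrow> 'l \<Rightarrow> int"
  where "C i j = \<lfloor>Re (pairing (\<alpha> i) (\<alpha> j))\<rfloor>"

lemma C: "of_int (C i j) = pairing (\<alpha> i) (\<alpha> j)"
  using pairing_integral[OF simple_root simple_root, of i j] by (auto simp: C_def elim!: Ints_cases)

lemma C_self: "C i i = 2"
  using C[of i i] pairing_self[OF simple_root, of i] by (metis of_int_eq_iff of_int_numeral)

lemma C_commute: "C i j = C j i"
  using C[of i j] C[of j i] pairing_commute[OF simple_root simple_root, of i j] by (metis of_int_eq_iff)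

lemma shift_row: "(\<Sum>j\<in>UNIV. shift n i k j * C j i) = (\<Sum>j\<in>UNIV. n j * C j i) + 2 * k"
proof -
  have "(\<Sum>j\<in>UNIV. shift n i k j * C j i) = (\<Sum>j\<in>UNIV. n j * C j i + (if j = i then 2 * k else 0))"
    by (intro sum.cong) (auto simp: distrib_right C_self)
  then show ?thesis by (simp add: sum.distrib)
qed

lemma cartan_matrix_C: "cartan_matrix B H \<alpha> i j = of_int (C i j)"
  by (simp add: cartan_matrix_def dual_form_pairing simple_root pairing_self C)

lemma dual_vector_wt:
  assumes v: "v \<in> wt n r"
  shows "mode (dual_vector B H (\<alpha> i)) 0 v = of_int (\<Sum>j\<in>UNIV. n j * C j i) *v v"
proof -
  let ?t = "dual_vector B H (\<alpha> i)"
  have "Vector_Spaces.linear (*s) (*v) (\<lambda>a. mode a 0 v)"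
    by (simp add: Vector_Spaces.linear_iff vector_space_axioms M.V.vector_space_axioms mode_add mode_scale)
  then interpret l: Vector_Spaces.linear "(*s)" "(*v)" "\<lambda>a. mode a 0 v" .
  have "mode ?t 0 v = mode (\<Sum>j\<in>UNIV. \<alpha> j ?t *s \<omega> j) 0 v"
    using coweight_expansion[OF dual_vector_root(1)[OF simple_root]] by simp
  also have "\<dots> = (\<Sum>j\<in>UNIV. (of_int (n j * C j i)) *v v)"
    using v by (simp add: l.sum l.scale wt_def mult.commute flip: C)
  finally show ?thesis by (simp add: M.V.scale_sum_left)
qed

definition wt_iso :: "'v set \<Rightarrow> 'v set \<Rightarrow> bool"
  where "wt_iso X Y \<longleftrightarrow> (\<exists>T. Vector_Spaces.linear (*v) (*v) T \<and> bij_betw T X Y)"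

lemma wt_iso_trans: "wt_iso X Y \<Longrightarrow> wt_iso Y Z \<Longrightarrow> wt_iso X Z"
  unfolding wt_iso_def
  by (meson bij_betw_trans Vector_Spaces.linear_compose)

lemma linear_mode_power: "Vector_Spaces.linear (*v) (*v) (mode e m ^^ l)"
  by (induction l)
    (auto simp: Vector_Spaces.linear_iff M.V.vector_space_axioms M.act_add_right M.act_scale_right)

lemma reflection:
  fixes n :: "'l \<Rightarrow> int"
  assumes m: "- 1 \<le> m" "m \<le> 1" and k: "k = (\<Sum>j\<in>UNIV. n j * C j i) + m"
  shows "wt_iso (wt n r) (wt (shift n i (- k)) (r + m * k))"
proof -
  note s = simple_root[of i]
  obtain e where e: "e \<in> root_space H (\<alpha> i)" "e \<noteq> 0" using root_vector[OF s] .
  obtain f where f: "f \<in> root_space H (\<lambda>h. - \<alpha> i h)" "B e f = 1"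
    using opposite_root_vector[OF s e] .
  let ?t = "dual_vector B H (\<alpha> i)"
  let ?E = "mode e m" and ?F = "mode f (- m)" and ?H = "\<lambda>v. mode ?t 0 v + of_int m *v v"
  have ef: "\<lbrakk>e, f\<rbrakk> = ?t" using bracket_opposite[OF s e(1) f(1)] f(2) by simp
  have te: "\<lbrakk>?t, e\<rbrakk> = 2 *s e" "\<lbrakk>?t, f\<rbrakk> = (- 2) *s f"
    using root_spaceD[OF e(1) dual_vector_root(1)[OF s]] root_spaceD[OF f(1) dual_vector_root(1)[OF s]]
    by (simp_all add: pairing_self s)
  interpret sl2: sl2_action vscale ?E ?F ?H
  proof
    show "?E (?F v) = ?F (?E v) + ?H v" for v
      by (simp add: mode_commute[of e m] ef f(2) add.assoc)
    show "?H (?E v) = ?E (?H v) + 2 *v ?E v" for v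
      by (simp add: mode_commute[of ?t 0] te mode_scale mode_minus M.act_add_right M.act_scale_right algebra_simps)
    show "?H (?F v) = ?F (?H v) + (- 2) *v ?F v" for v
      by (simp add: mode_commute[of ?t 0] te mode_scale mode_minus M.act_add_right M.act_scale_right algebra_simps)
  qed (simp_all add: M.act_add_right M.act_scale_right)
  have nil: "\<exists>N. (?E ^^ N) v = 0" "\<exists>N. (?F ^^ N) v = 0" for v
    using m by (auto intro!: locally_nilpotent root_vector_extremal[OF s e(1)]
        root_vector_isotropic[OF s e(1)] root_vector_extremal[OF neg_root[OF s] f(1)]
        root_vector_isotropic[OF neg_root[OF s] f(1)])
  have coE: "\<alpha> i (\<omega> j) = of_int (if j = i then 1 else 0)" for j
    by (simp add: coweight)
  have coF: "- \<alpha> i (\<omega> j) = of_int (if j = i then - 1 else 0)" for j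
    by (simp add: coweight)
  have E: "?E v \<in> wt (shift n i 1) (r - m)" if "v \<in> wt n r" for v n r
    by (rule mode_wt[OF e(1) coE that])
  have F: "?F v \<in> wt (shift n i (- 1)) (r + m)" if "v \<in> wt n r" for v n r
    using mode_wt[OF f(1) coF that, of "- m"] by simp
  have shifts: "shift (shift n i a) i b = shift n i (a + b)" for n :: "'l \<Rightarrow> int" and a b
    by auto
  have shift0: "shift n i 0 = n" for n :: "'l \<Rightarrow> int" by simp
  have FE: "?F (?E v) \<in> wt n r" if "v \<in> wt n r" for v n r
    using F[OF E[OF that]] unfolding shifts by (simp cong: if_cong)
  have EF: "?E (?F v) \<in> wt n r" if "v \<in> wt n r" for v n r
    using E[OF F[OF that]] unfolding shifts by (simp cong: if_cong)
  let ?n = "shift n i (- k)" and ?r = "r + m * k"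
  have H: "?H v = of_int k *v v" if "v \<in> wt n r" for v r
    using dual_vector_wt[OF that, of i] by (simp add: k M.V.scale_left_distrib)
  have n': "(\<Sum>j\<in>UNIV. ?n j * C j i) + m = - k"
    unfolding shift_row using k by simp
  have H': "?H v = - of_int k *v v" if "v \<in> wt ?n r" for v r
  proof -
    have "?H v = of_int ((\<Sum>j\<in>UNIV. ?n j * C j i) + m) *v v"
      unfolding dual_vector_wt[OF that, of i] of_int_add M.V.scale_left_distrib ..
    then show ?thesis unfolding n' by simp
  qed
  show ?thesis
  proof (cases "k \<ge> 0")
    case True
    have "bij_betw (?F ^^ nat k) (wt n r) (wt ?n ?r)"
    proof (rule sl2.reflection_bij)
      show "(?F ^^ nat k) v \<in> wt ?n ?r" if "v \<in> wt n r" for v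
        using mode_power_wt[OF f(1) coF that, where m = "- m" and l = "nat k"] True by (simp add: mult.commute cong: if_cong)
      show "(?E ^^ nat k) v \<in> wt n r" if "v \<in> wt ?n ?r" for v
        using mode_power_wt[OF e(1) coE that, where m = m and l = "nat k"] True
        by (simp add: shifts shift0 mult.commute cong: if_cong)
    qed (use True in \<open>simp_all add: subspace_wt FE EF H H' nil\<close>)
    then show ?thesis unfolding wt_iso_def using linear_mode_power by blast
  next
    case False
    interpret swap: sl2_action vscale ?F ?E "\<lambda>v. - ?H v" by (rule sl2.swap)
    have "bij_betw (?E ^^ nat (- k)) (wt n r) (wt ?n ?r)"
    proof (rule swap.reflection_bij)
      show "(?E ^^ nat (- k)) v \<in> wt ?n ?r" if "v \<in> wt n r" for v
        using mode_power_wt[OF e(1) coE that, where m = m and l = "nat (- k)"] False by (simp add: mult.commute cong: if_cong)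
      show "(?F ^^ nat (- k)) v \<in> wt n r" if "v \<in> wt ?n ?r" for v
        using mode_power_wt[OF f(1) coF that, where m = "- m" and l = "nat (- k)"] False
        by (simp add: shifts shift0 mult.commute cong: if_cong)
    qed (use False in \<open>simp_all add: subspace_wt FE EF H H' nil\<close>)
    then show ?thesis unfolding wt_iso_def using linear_mode_power by blast
  qed
qed

text \<open>With \<open>p = (\<lambda>, \<alpha>\<^sub>i)\<close>, the reflection for \<open>m = 0\<close> leads to \<open>\<lambda> - p \<alpha>\<^sub>i\<close>, whose pairing with \<open>\<alpha>\<^sub>i\<close> is
  \<open>-p\<close>.  The one for \<open>m = -s\<close> then moves by \<open>p + s\<close> multiples of \<open>\<alpha>\<^sub>i\<close> and raises the degree by
  \<open>s (p + s)\<close>.\<close>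

lemma translation:
  assumes s: "s = 1 \<or> s = - 1"
  shows "wt_iso (wt n r) (wt (shift n i s) (r + 1 + s * (\<Sum>j\<in>UNIV. n j * C j i)))"
proof -
  define p where "p = (\<Sum>j\<in>UNIV. n j * C j i)"
  have 1: "wt_iso (wt n r) (wt (shift n i (- p)) r)"
    using reflection[of 0 p n i r] by (simp add: p_def)
  have "(\<Sum>j\<in>UNIV. shift n i (- p) j * C j i) = - p"
    unfolding shift_row p_def[symmetric] by simp
  then have 2: "wt_iso (wt (shift n i (- p)) r)
      (wt (shift (shift n i (- p)) i (- (- p - s))) (r + (- s) * (- p - s)))"
    using s by (intro reflection) auto
  have "shift (shift n i (- p)) i (- (- p - s)) = shift n i s" by auto
  moreover have "r + (- s) * (- p - s) = r + 1 + s * p" using s by (auto simp: algebra_simps)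
  ultimately show ?thesis using wt_iso_trans[OF 1 2] by (simp only: p_def)
qed

end

lemma int_vector_induct:
  fixes n :: "'l::finite \<Rightarrow> int"
  assumes zero: "P (\<lambda>_. 0)"
    and step: "\<And>n i s. P n \<Longrightarrow> s = 1 \<or> s = - 1 \<Longrightarrow> P (\<lambda>j. n j + (if j = i then s else 0))"
  shows "P n"
proof (induction "\<Sum>j\<in>UNIV. nat \<bar>n j\<bar>" arbitrary: n rule: less_induct)
  case less
  show ?case
  proof (cases "\<exists>i. n i \<noteq> 0")
    case True
    then obtain i where i: "n i \<noteq> 0" by blast
    let ?n = "\<lambda>j. n j + (if j = i then - sgn (n i) else 0)"
    have "(\<Sum>j\<in>UNIV. nat \<bar>?n j\<bar>) < (\<Sum>j\<in>UNIV. nat \<bar>n j\<bar>)"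
      by (rule sum_strict_mono_ex1) (use i in \<open>auto simp: sgn_if intro!: exI[of _ i]\<close>)
    then have "P ?n" by (rule less)
    from step[OF this, of "sgn (n i)" i] i
    have "P (\<lambda>j. ?n j + (if j = i then sgn (n i) else 0))" by (auto simp: sgn_if)
    moreover have "(\<lambda>j. ?n j + (if j = i then sgn (n i) else 0)) = n" by auto
    ultimately show ?thesis by simp
  next
    case False
    then have "n = (\<lambda>_. 0)" by auto
    then show ?thesis using zero by simp
  qed
qed

context affine_setup
begin

text \<open>A translation by \<open>s \<alpha>\<^sub>i\<close> with \<open>s = 1\<close> or \<open>s = -1\<close> changes \<open>(\<lambda>, \<lambda>) / 2\<close> by \<open>1 + s (\<lambda>, \<alpha>\<^sub>i)\<close>, the same as
  the degree.\<close>

lemma translation_lattice: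
  "\<exists>k. 2 * k = (\<Sum>i\<in>UNIV. \<Sum>j\<in>UNIV. n i * C i j * n j) \<and> (\<forall>r. wt_iso (wt (\<lambda>_. 0) r) (wt n (r + k)))"
proof (induction n rule: int_vector_induct)
  case 1
  have "Vector_Spaces.linear (*v) (*v) (\<lambda>v. v)"
    by (simp add: Vector_Spaces.linear_iff M.V.vector_space_axioms)
  then have "wt_iso X X" for X unfolding wt_iso_def by (intro exI[of _ "\<lambda>v. v"]) (simp add: bij_betw_def)
  then show ?case by (intro exI[of _ 0]) simp
next
  case (2 n i s)
  define p where "p = (\<Sum>j\<in>UNIV. n j * C j i)"
  obtain k where k: "2 * k = (\<Sum>i\<in>UNIV. \<Sum>j\<in>UNIV. n i * C i j * n j)"
    "\<And>r. wt_iso (wt (\<lambda>_. 0) r) (wt n (r + k))" using 2 by blast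
  have "wt_iso (wt (\<lambda>_. 0) r) (wt (shift n i s) (r + (k + 1 + s * p)))" for r
    using wt_iso_trans[OF k(2) translation[OF 2(2), of n "r + k" i]] by (simp add: p_def add.assoc)
  moreover have "(\<Sum>a\<in>UNIV. \<Sum>b\<in>UNIV. shift n i s a * C a b * shift n i s b) = 2 * (k + 1 + s * p)"
  proof -
    let ?d = "\<lambda>j. if j = i then s else 0"
    have d: "(\<Sum>a\<in>UNIV. ?d a * y a) = s * y i" for y
    proof -
      have "(\<Sum>a\<in>UNIV. ?d a * y a) = (\<Sum>a\<in>UNIV. if a = i then s * y a else 0)"
        by (intro sum.cong) auto
      then show ?thesis by simp
    qed
    have p': "(\<Sum>b\<in>UNIV. C i b * n b) = p" by (simp add: p_def C_commute[of i] mult.commute)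
    have "(\<Sum>a\<in>UNIV. \<Sum>b\<in>UNIV. shift n i s a * C a b * shift n i s b) =
        (\<Sum>a\<in>UNIV. \<Sum>b\<in>UNIV. n a * C a b * n b) + (\<Sum>a\<in>UNIV. \<Sum>b\<in>UNIV. n a * C a b * ?d b)
        + (\<Sum>a\<in>UNIV. \<Sum>b\<in>UNIV. ?d a * (C a b * n b)) + (\<Sum>a\<in>UNIV. \<Sum>b\<in>UNIV. ?d a * (C a b * ?d b))"
      by (simp only: distrib_left distrib_right sum.distrib mult.assoc add.assoc)
    also have "(\<Sum>a\<in>UNIV. \<Sum>b\<in>UNIV. n a * C a b * ?d b) = s * p"
      by (simp add: p_def if_distrib sum_distrib_left mult.commute cong: if_cong)
    also have "(\<Sum>a\<in>UNIV. \<Sum>b\<in>UNIV. ?d a * (C a b * n b)) = s * p"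
      by (simp only: d p' flip: sum_distrib_left)
    also have "(\<Sum>a\<in>UNIV. \<Sum>b\<in>UNIV. ?d a * (C a b * ?d b)) = 2"
      using 2(2) unfolding sum_distrib_left[symmetric] d mult.commute[of "C _ _"] by (auto simp: C_self)
    finally show ?thesis using k(1) by simp
  qed
  ultimately show ?case by (metis (no_types, lifting))
qed

text \<open>The exponent is nonnegative because the image of the vacuum has it as degree.  Below it the
  coefficients vanish, since the corresponding spaces of weight \<open>0\<close> have negative degree.\<close>

lemma character_coeff_shift:
  "\<exists>k::nat. 2 * int k = (\<Sum>i\<in>UNIV. \<Sum>j\<in>UNIV. n i * C i j * n j) \<and>
    M.character_coeff \<omega> L0 n = M.character_coeff \<omega> L0 (\<lambda>_. 0) * fps_X ^ k"
proof -
  obtain k where k: "2 * k = (\<Sum>i\<in>UNIV. \<Sum>j\<in>UNIV. n i * C i j * n j)"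
    "\<And>r. wt_iso (wt (\<lambda>_. 0) r) (wt n (r + k))"
    using translation_lattice by blast
  have "k \<ge> 0"
  proof (rule ccontr)
    assume neg: "\<not> k \<ge> 0"
    obtain T where T: "Vector_Spaces.linear (*v) (*v) T" "bij_betw T (wt (\<lambda>_. 0) 0) (wt n k)"
      using k(2)[of 0] by (auto simp: wt_iso_def)
    interpret T: Vector_Spaces.linear "(*v)" "(*v)" T by (rule T(1))
    have vac: "vac \<in> wt (\<lambda>_. 0) 0" by (simp add: wt_def M.vac_annihilated L0_vac)
    then have "T vac = 0" using T(2) wt_negative[of k _ n] neg by (auto simp: bij_betw_def)
    then have "T vac = T 0" by (simp add: T.zero)
    then have "vac = 0"
      using T(2) vac M.V.subspace_0[OF subspace_wt] by (meson bij_betw_def inj_onD)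
    then show False using vac_nonzero by simp
  qed
  then obtain l where l: "k = int l" using nonneg_eq_int by blast
  have dim: "M.V.dim (wt n (r + k)) = M.V.dim (wt (\<lambda>_. 0) r)" for r
    using k(2)[of r] M.V.linear_iso_dim[OF _ _ subspace_wt] unfolding wt_iso_def by metis
  have "M.character_coeff \<omega> L0 n = M.character_coeff \<omega> L0 (\<lambda>_. 0) * fps_X ^ l"
  proof (rule fps_ext)
    fix r
    have eq: "fps_nth (M.character_coeff \<omega> L0 n) r = of_nat (M.V.dim (wt n (int r)))" for n r
      by (simp add: M.character_coeff_def wt_weight_space)
    show "fps_nth (M.character_coeff \<omega> L0 n) r = fps_nth (M.character_coeff \<omega> L0 (\<lambda>_. 0) * fps_X ^ l) r"
    proof (cases "r < l")
      case True
      then have "wt (\<lambda>_. 0) (int r - k) \<subseteq> {0}" using wt_negative[of "int r - k"] l by auto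
      then have "M.V.dim (wt (\<lambda>_. 0) (int r - k)) \<le> card ({} :: 'v set)"
        by (intro M.V.dim_le_card) auto
      then show ?thesis using True dim[of "int r - k"] by (simp add: fps_X_power_mult_right_nth eq)
    next
      case False
      then show ?thesis using dim[of "int (r - l)"] l
        by (simp add: fps_X_power_mult_right_nth eq of_nat_diff)
    qed
  qed
  then show ?thesis using k(1) l by auto
qed

end

theorem mainTheorem3:
  fixes scale :: "complex \<Rightarrow> 'g::ab_group_add \<Rightarrow> 'g"
    and bracket :: "'g \<Rightarrow> 'g \<Rightarrow> 'g"
    and H :: "'g set"
    and \<alpha> :: "'l::finite \<Rightarrow> 'g \<Rightarrow> complex"
    and \<omega> :: "'l \<Rightarrow> 'g"
    and B :: "'g \<Rightarrow> 'g \<Rightarrow> complex"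
    and vscale :: "complex \<Rightarrow> 'v::ab_group_add \<Rightarrow> 'v"
    and act :: "'g affine \<Rightarrow> 'v \<Rightarrow> 'v"
    and vac :: 'v
    and L0 :: "'v \<Rightarrow> 'v"
    and n :: "'l \<Rightarrow> int"
  assumes "lie_algebra scale bracket"
    and "lie_algebra.finite_dim scale"
    and "lie_algebra.simple scale bracket"
    and "lie_algebra.cartan_subalgebra scale bracket H"
    and "vector_space.dim scale H = CARD('l)"
    and "lie_algebra.simply_laced scale bracket H"
    and "lie_algebra.simple_roots scale bracket H \<alpha>"
    and "lie_algebra.normalized_killing_form scale bracket H B"
    and "lie_algebra.fundamental_coweights H \<alpha> \<omega>"
    and "basic_module scale bracket B vscale act vac"
    and "basic_module.degree_operator vscale act vac L0"
  shows "\<exists>k::nat.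
    of_nat k = (1 / 2) * (\<Sum>i\<in>UNIV. \<Sum>j\<in>UNIV. of_int (n i) * lie_algebra.cartan_matrix B H \<alpha> i j * of_int (n j)) \<and>
    basic_module.character_coeff vscale act \<omega> L0 n =
      basic_module.character_coeff vscale act \<omega> L0 (\<lambda>_. 0) * fps_X ^ k"
proof -
  interpret root_datum scale bracket H \<alpha> \<omega> B
    using assms by (simp add: root_datum_def root_datum_axioms_def)
  interpret affine_setup scale bracket H \<alpha> \<omega> B vscale act vac L0
    using assms root_datum_axioms by (simp add: affine_setup_def affine_setup_axioms_def)
  obtain k :: nat where k: "2 * int k = (\<Sum>i\<in>UNIV. \<Sum>j\<in>UNIV. n i * C i j * n j)"
    and ch: "M.character_coeff \<omega> L0 n = M.character_coeff \<omega> L0 (\<lambda>_. 0) * fps_X ^ k"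
    using character_coeff_shift by blast
  have "2 * of_nat k = (of_int (2 * int k) :: complex)" by simp
  also have "\<dots> = (\<Sum>i\<in>UNIV. \<Sum>j\<in>UNIV. of_int (n i) * cartan_matrix B H \<alpha> i j * of_int (n j))"
    unfolding k by (simp add: cartan_matrix_C)
  finally show ?thesis using ch by (intro exI[of _ k]) (simp add: field_simps)
qed

end
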